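(* Let $d\ge2$ and $1\le j\le d-1$. Let $\mathbb P$ be a probability measure on $C^0(\mathbb T^d,\mathbb R^{d-j})$ and assume that (a) for some $\alpha>\frac{j}{2+j}$, $\phi\in C^{1,\alpha}(\mathbb T^d;\mathbb R^{d-j})$ $\mathbb P$-almost surely; (b) there is a fixed constant $C_0$ such that $\mathbb P(\{\phi:|D\phi(x_0)-M_0|\le r\})\le C_0\,r^{d(d-j)}$ for all $r>0$, all $x_0\in\mathbb T^d$ and all $M_0\in\mathbb R^{(d-j)\times d}$. Then $\mathbb P$-almost surely $\phi$ has the classical Morse--Sard property, namely $\phi^{-1}(y)$ is a $j$-dimensional $C^1$ submanifold of $\mathbb T^d$ for a.e. $y\in\mathbb R^{d-j}$.
   Context: $\mathbb T^d=\mathbb R^d/\mathbb Z^d$ is the flat torus. $\mathbb P$ is a Borel probability measure. $D\phi(x)$ is the $(d-j)\times d$ Jacobian matrix. "A.e. $y$" is with respect to Lebesgue measure on $\mathbb R^{d-j}$; the empty set counts as a $j$-dimensional submanifold. *)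

theory Defs
  imports "HOL-Probability.Probability"
begin

quotient_type (overloaded) 'd torus = "real ^ 'd::finite" /
  "\<lambda>x y. \<forall>i. x $ i - y $ i \<in> \<int>"
  morphisms rep_torus to_torus
proof (rule equivpI)
  show "reflp (\<lambda>x y :: real ^ 'd. \<forall>i. x $ i - y $ i \<in> \<int>)"
    by (simp add: reflp_def)
  show "symp (\<lambda>x y :: real ^ 'd. \<forall>i. x $ i - y $ i \<in> \<int>)"
    unfolding symp_def by (metis Ints_minus minus_diff_eq)
  show "transp (\<lambda>x y :: real ^ 'd. \<forall>i. x $ i - y $ i \<in> \<int>)"
  proof (rule transpI, rule allI)
    fix x y z :: "real ^ 'd" and i
    assume "\<forall>i. x $ i - y $ i \<in> \<int>" "\<forall>i. y $ i - z $ i \<in> \<int>"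
    then have "(x $ i - y $ i) + (y $ i - z $ i) \<in> \<int>" by (intro Ints_add) auto
    then show "x $ i - z $ i \<in> \<int>" by simp
  qed
qed

instantiation torus :: (finite) topological_space
begin

definition open_torus :: "'a torus set \<Rightarrow> bool"
  where "open_torus U \<longleftrightarrow> open (to_torus -` U :: (real ^ 'a) set)"

instance
  by standard (auto simp: open_torus_def vimage_Int vimage_Union)

end

lemma continuous_on_to_torus: "continuous_on S to_torus"
  by (rule continuous_on_subset[of UNIV])
    (auto simp: continuous_on_open_vimage open_torus_def)

lemma compact_torus: "compact (UNIV :: 'd::finite torus set)"
proof -
  have "p \<in> to_torus ` cbox 0 1" for p :: "'d torus"
  proof -
    define x where "x = (\<chi> i. frac (rep_torus p $ i))"
    have "to_torus x = to_torus (rep_torus p)"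
      by (auto simp: torus.abs_eq_iff x_def frac_def)
    then have "to_torus x = p"
      by (simp add: Quotient_abs_rep[OF Quotient_torus])
    moreover have "x \<in> cbox 0 1"
      by (auto simp: mem_box_cart x_def frac_lt_1 less_imp_le)
    ultimately show ?thesis by blast
  qed
  then have "(UNIV :: 'd torus set) = to_torus ` cbox 0 1" by blast
  then show ?thesis
    by (metis compact_cbox compact_continuous_image continuous_on_to_torus)
qed

text \<open>By compactness, bounded continuous functions on the torus are all the continuous
  functions; so the type \<open>'d torus \<Rightarrow>\<^sub>C (real ^ 'm)\<close> with its supremum metric is
  $C^0(\mathbb{T}^d, \mathbb{R}^m)$.\<close>

lemma bcontfun_torus:
  "bcontfun = {f :: 'd::finite torus \<Rightarrow> 'b::metric_space. continuous_on UNIV f}"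
proof -
  have "bounded (range f)" if "continuous_on UNIV f" for f :: "'d torus \<Rightarrow> 'b"
    using compact_continuous_image[OF that compact_torus] by (rule compact_imp_bounded)
  then show ?thesis by (auto simp: bcontfun_def)
qed

definition torus_lift :: "('d::finite torus \<Rightarrow> 'b) \<Rightarrow> real ^ 'd \<Rightarrow> 'b"
  where "torus_lift f = f \<circ> to_torus"

definition torus_differentiable :: "('d::finite torus \<Rightarrow> real ^ 'm::finite) \<Rightarrow> 'd torus \<Rightarrow> bool"
  where "torus_differentiable f p \<longleftrightarrow> torus_lift f differentiable at (rep_torus p)"

definition torus_jacobian :: "('d::finite torus \<Rightarrow> real ^ 'm::finite) \<Rightarrow> 'd torus \<Rightarrow> real ^ 'd ^ 'm"
  where "torus_jacobian f p = jacobian (torus_lift f) (at (rep_torus p))"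

text \<open>Neither notion depends on the chosen representative of \<open>p\<close>.\<close>

lemma has_derivative_torus_lift_shift:
  fixes f :: "'d::finite torus \<Rightarrow> real ^ 'm::finite"
  assumes "to_torus x = to_torus y" "(torus_lift f has_derivative D) (at x)"
  shows "(torus_lift f has_derivative D) (at y)"
proof -
  have "torus_lift f (z + (x - y)) = torus_lift f z" for z
  proof -
    have "to_torus (z + (x - y)) = to_torus z"
      using assms(1) by (simp add: torus.abs_eq_iff)
    then show ?thesis by (simp add: torus_lift_def)
  qed
  then have eq: "torus_lift f \<circ> (\<lambda>z. z + (x - y)) = torus_lift f"
    by (simp add: fun_eq_iff)
  have "((\<lambda>z. z + (x - y)) has_derivative (\<lambda>h. h)) (at y)"
    by (auto intro!: derivative_eq_intros)
  from diff_chain_at[OF this, of "torus_lift f" D] assms(2)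
  show ?thesis by (simp add: eq comp_def[of D])
qed

lemma torus_differentiable_to_torus:
  "torus_differentiable f (to_torus x) \<longleftrightarrow> torus_lift f differentiable at x"
  and torus_jacobian_to_torus:
  "torus_jacobian f (to_torus x) = jacobian (torus_lift f) (at x)"
proof -
  have "to_torus (rep_torus (to_torus x)) = to_torus x"
    by (simp add: Quotient_abs_rep[OF Quotient_torus])
  then have "(torus_lift f has_derivative D) (at (rep_torus (to_torus x)))
      \<longleftrightarrow> (torus_lift f has_derivative D) (at x)" for D
    using has_derivative_torus_lift_shift by metis
  then show "torus_differentiable f (to_torus x) \<longleftrightarrow> torus_lift f differentiable at x"
    and "torus_jacobian f (to_torus x) = jacobian (torus_lift f) (at x)"
    by (simp_all add: torus_differentiable_def torus_jacobian_def differentiable_def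
        jacobian_def frechet_derivative_def)
qed

text \<open>The flat distance of two points of the torus is the minimal distance of their
  representatives, so Hoelder continuity of the derivative with respect to it is Hoelder
  continuity of the derivative of the lift.\<close>

definition torus_C1_holder :: "real \<Rightarrow> ('d::finite torus \<Rightarrow> real ^ 'm::finite) \<Rightarrow> bool"
  where "torus_C1_holder \<alpha> f \<longleftrightarrow>
    (\<forall>p. torus_differentiable f p) \<and>
    continuous_on UNIV (torus_jacobian f) \<and>
    (\<exists>K. \<forall>x y. norm (torus_jacobian f (to_torus x) - torus_jacobian f (to_torus y))
                \<le> K * dist x y powr \<alpha>)"

definition C1_on :: "(real ^ 'n::finite) set \<Rightarrow> (real ^ 'n \<Rightarrow> real ^ 'm::finite) \<Rightarrow> bool"
  where "C1_on U f \<longleftrightarrow>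
    (\<forall>x\<in>U. f differentiable at x) \<and>
    continuous_on U (\<lambda>x. jacobian f (at x))"

definition C1_diffeomorphism ::
    "(real ^ 'n::finite) set \<Rightarrow> (real ^ 'n) set \<Rightarrow> (real ^ 'n \<Rightarrow> real ^ 'n) \<Rightarrow> bool"
  where "C1_diffeomorphism U V h \<longleftrightarrow>
    open U \<and> open V \<and> C1_on U h \<and> (\<exists>g. homeomorphism U V h g \<and> C1_on V g)"

text \<open>Embedded submanifolds, by slice charts. The open sets \<open>U\<close> on which \<open>to_torus\<close> is
  injective are the domains of the standard local parametrizations of the torus. The empty
  set is a submanifold of every dimension.\<close>

definition torus_C1_submanifold :: "nat \<Rightarrow> 'd::finite torus set \<Rightarrow> bool"
  where "torus_C1_submanifold k S \<longleftrightarrow>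
    (\<forall>p\<in>S. \<exists>U V h I.
      inj_on to_torus U \<and> p \<in> to_torus ` U \<and> C1_diffeomorphism U V h \<and> card I = k \<and>
      h ` (U \<inter> to_torus -` S) = V \<inter> {z :: real ^ 'd. \<forall>i. i \<notin> I \<longrightarrow> z $ i = 0})"

definition morse_sard :: "nat \<Rightarrow> ('d::finite torus \<Rightarrow> real ^ 'm::finite) \<Rightarrow> bool"
  where "morse_sard j f \<longleftrightarrow> (AE y in lebesgue. torus_C1_submanifold j (f -` {y}))"

end

theory Submission
  imports Defs
begin

text \<open>
  Cut the torus into $\epsilon^{-d}$ cubes of side $\epsilon = 2^{-n}$ and put
  $\delta = \epsilon^\alpha$, $m = d - j$. If a cube contains a critical point, then by the Hoelder
  condition the Jacobian at its corner is within $O(\delta)$ of a matrix of rank less than $m$.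
  Such matrices have codimension $j + 1$, so a bounded set of them is covered by
  $O(\delta^{-(dm - j - 1)})$ balls of radius $\delta$, and by (b) a given cube contains critical
  points with probability $O(\delta^{j+1})$. The image of such a cube lies in a slab of diameter
  $O(\epsilon)$ and width $O(\epsilon\delta)$, so its volume is $O(\epsilon^{m+\alpha})$. Hence the
  critical values are covered by a set of expected volume $O(\epsilon^{\alpha(j+2)-j})$, which tends
  to $0$, and almost surely they form a null set. The fibres over regular values are submanifolds
  by the inverse function theorem.
\<close>

subsection \<open>Degenerate matrices and slabs\<close>

text \<open>The Hoelder constant depends on \<open>\<phi>\<close>, while the net and the volume
  bounds need a fixed one. So the estimate is made for each natural constant, and the countably many
  exceptional null sets are united. Measurability shapes the rest. The random volume is the number
  of such cubes times a deterministic volume. It is defined for every \<open>\<phi>\<close> and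
  bounds the cover only for those with the given constant, so no measurability of the Hoelder class
  is involved. The codimension j + 1 is (d - (m - 1)) (m - (m - 1)), that of the matrices of rank m
  - 1. The slab is thin because a dependency among the rows of a degenerate Jacobian is a covector
  that annihilates its range: in that direction only the Taylor remainder is left.\<close>

lemma norm_matrix_vector_mult_le:
  fixes A :: "real ^ 'd::finite ^ 'm::finite"
  shows "norm (A *v x) \<le> norm A * norm x"
proof -
  have "norm (A *v x) \<le> L2_set (\<lambda>i. norm (A $ i) * norm x) UNIV"
    unfolding norm_vec_def[of "A *v x"]
    by (rule L2_set_mono) (auto simp: matrix_vector_mul_component Cauchy_Schwarz_ineq2)
  also have "\<dots> = norm A * norm x"
    by (simp add: norm_vec_def[of A] L2_set_left_distrib)
  finally show ?thesis .
qed

lemma norm_matrix_le_entries: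
  fixes A :: "real ^ 'd::finite ^ 'm::finite"
  assumes "\<And>k l. \<bar>A $ k $ l\<bar> \<le> B"
  shows "norm A \<le> real CARD('m) * (real CARD('d) * B)"
proof -
  have "norm (A $ k) \<le> real CARD('d) * B" for k
    using norm_le_l1_cart[of "A $ k"] sum_bounded_above[of UNIV "\<lambda>l. \<bar>A $ k $ l\<bar>" B] assms
    by simp
  then have "(\<Sum>k\<in>UNIV. norm (A $ k)) \<le> real CARD('m) * (real CARD('d) * B)"
    using sum_bounded_above[of UNIV "\<lambda>k. norm (A $ k)" "real CARD('d) * B"] by simp
  moreover have "norm A \<le> (\<Sum>k\<in>UNIV. norm (A $ k))"
    unfolding norm_vec_def by (rule L2_set_le_sum) auto
  ultimately show ?thesis by linarith
qed

text \<open>A matrix that is not right invertible has dependent rows. Dividing by the coefficient of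
  largest modulus makes one coefficient 1 and leaves the others in [-1, 1]; this keeps their
  roundings in a bounded grid and lets one coordinate of a slab be solved for.\<close>

lemma not_surj_obtain_dependency:
  fixes A :: "real ^ 'd::finite ^ 'm::finite"
  assumes "\<not> surj ((*v) A)"
  obtains c i where "c i = 1" "\<And>k. \<bar>c k\<bar> \<le> (1::real)" "(\<Sum>k\<in>UNIV. c k *\<^sub>R A $ k) = 0"
proof -
  obtain b k where b: "(\<Sum>k\<in>UNIV. b k *s row k A) = 0" "b k \<noteq> 0"
    using assms matrix_right_invertible_independent_rows[of A]
      matrix_right_invertible_surjective[of A] by blast
  have "Max (range (\<lambda>k. \<bar>b k\<bar>)) \<in> range (\<lambda>k. \<bar>b k\<bar>)" by (intro Max_in) auto
  then obtain i where "Max (range (\<lambda>k. \<bar>b k\<bar>)) = \<bar>b i\<bar>" by blast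
  then have i: "\<bar>b k\<bar> \<le> \<bar>b i\<bar>" for k by (metis Max_ge finite finite_imageI rangeI)
  have "b i \<noteq> 0" using i[of k] b(2) by auto
  show thesis
  proof (rule that[of "\<lambda>k. b k / b i" i])
    show "b i / b i = 1" using \<open>b i \<noteq> 0\<close> by simp
    show "\<bar>b k / b i\<bar> \<le> 1" for k using i[of k] \<open>b i \<noteq> 0\<close> by (simp add: divide_le_eq)
    have "(\<Sum>k\<in>UNIV. (b k / b i) *\<^sub>R A $ k) = (1 / b i) *\<^sub>R (\<Sum>k\<in>UNIV. b k *s row k A)"
      by (simp add: scaleR_sum_right row_def vec_nth_inverse scalar_mult_eq_scaleR)
    then show "(\<Sum>k\<in>UNIV. (b k / b i) *\<^sub>R A $ k) = 0" using b(1) by simp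
  qed
qed

section \<open>Rounding to multiples of a step\<close>

lemma floor_grid_bounds:
  fixes x \<delta> :: real
  assumes "\<delta> > 0"
  shows "\<delta> * of_int \<lfloor>x / \<delta>\<rfloor> \<le> x" "x \<le> \<delta> * of_int \<lfloor>x / \<delta>\<rfloor> + \<delta>"
proof -
  have "of_int \<lfloor>x / \<delta>\<rfloor> \<le> x / \<delta>" "x / \<delta> \<le> of_int \<lfloor>x / \<delta>\<rfloor> + 1" by linarith+
  then have "of_int \<lfloor>x / \<delta>\<rfloor> * \<delta> \<le> x" "x \<le> (of_int \<lfloor>x / \<delta>\<rfloor> + 1) * \<delta>"
    using assms by (simp_all only: pos_le_divide_eq pos_divide_le_eq)
  then show "\<delta> * of_int \<lfloor>x / \<delta>\<rfloor> \<le> x" "x \<le> \<delta> * of_int \<lfloor>x / \<delta>\<rfloor> + \<delta>"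
    by (simp_all add: distrib_left mult.commute)
qed

lemma abs_diff_floor_grid:
  fixes x \<delta> :: real
  assumes "\<delta> > 0"
  shows "\<bar>x - \<delta> * of_int \<lfloor>x / \<delta>\<rfloor>\<bar> \<le> \<delta>"
  using floor_grid_bounds[OF assms, of x] assms by (simp add: abs_le_iff)

lemma floor_divide_grid_mem:
  fixes x \<delta> K :: real
  assumes "\<delta> > 0" "\<bar>x\<bar> \<le> K"
  shows "\<lfloor>x / \<delta>\<rfloor> \<in> {- \<lceil>K / \<delta>\<rceil>..\<lceil>K / \<delta>\<rceil>}"
proof -
  have "- (K / \<delta>) \<le> x / \<delta>" "x / \<delta> \<le> K / \<delta>"
    using assms by (auto simp: field_simps abs_le_iff)
  then have "- \<lceil>K / \<delta>\<rceil> \<le> \<lfloor>x / \<delta>\<rfloor>" "\<lfloor>x / \<delta>\<rfloor> \<le> \<lceil>K / \<delta>\<rceil>" by linarith+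
  then show ?thesis by simp
qed

lemma card_ceiling_grid_le:
  fixes K \<delta> :: real
  assumes "0 < \<delta>" "0 \<le> K"
  shows "real (card {- \<lceil>K / \<delta>\<rceil>..\<lceil>K / \<delta>\<rceil>}) * \<delta> \<le> 2 * K + 3 * \<delta>"
proof -
  have "0 \<le> \<lceil>K / \<delta>\<rceil>" using assms by (simp add: order_less_le_trans[of "-1" 0])
  then have "real (card {- \<lceil>K / \<delta>\<rceil>..\<lceil>K / \<delta>\<rceil>}) = 2 * of_int \<lceil>K / \<delta>\<rceil> + 1" by simp
  also have "\<dots> \<le> 2 * (K / \<delta> + 1) + 1"
    using of_int_ceiling_le_add_one[of "K / \<delta>"] by argo
  finally have "real (card {- \<lceil>K / \<delta>\<rceil>..\<lceil>K / \<delta>\<rceil>}) * \<delta> \<le> (2 * (K / \<delta> + 1) + 1) * \<delta>"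
    using assms by (intro mult_right_mono) auto
  also have "\<dots> = 2 * K + 3 * \<delta>" using assms by (simp add: field_simps)
  finally show ?thesis .
qed

text \<open>A degenerate matrix is given by a row \<open>i\<close>, the other \<open>m - 1\<close> rows and the \<open>m - 1\<close>
  coefficients that express row \<open>i\<close> by them. Rounding these \<open>N\<close> numbers to multiples of \<open>\<delta>\<close>
  gives the net; the index \<open>None\<close> stands for the coefficient.\<close>

lemma degenerate_matrix_net:
  fixes K \<delta> :: real
  assumes "1 \<le> K" "0 < \<delta>" "\<delta> \<le> 1"
  defines "N \<equiv> (CARD('m) - 1) * (CARD('d) + 1)"
  obtains Z :: "(real ^ 'd::finite ^ 'm::finite) set"
  where "finite Z" "real (card Z) * \<delta> ^ N \<le> CARD('m) * (2 * K + 3) ^ N"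
    "\<And>A. \<not> surj ((*v) A) \<Longrightarrow> norm A \<le> K \<Longrightarrow>
       \<exists>M\<in>Z. norm (A - M) \<le> CARD('m) * (CARD('d) * (CARD('m) * ((K + 2) * \<delta>)))"
proof -
  define G where "G = {- \<lceil>K / \<delta>\<rceil>..\<lceil>K / \<delta>\<rceil>}"
  define F where "F = (\<lambda>i. PiE ((UNIV - {i}) \<times> UNIV) (\<lambda>_. G) :: ('m \<times> 'd option \<Rightarrow> int) set)"
  \<comment> \<open>Decoding of the rounded data: row \<open>i\<close> is recomputed from the
    rounded coefficients and rows, so it costs no further parameters.\<close>
  define mk where "mk = (\<lambda>i b. (\<chi> k l. if k = i
      then - (\<Sum>k\<in>UNIV - {i}. (\<delta> * of_int (b (k, None))) * (\<delta> * of_int (b (k, Some l))))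
      else \<delta> * of_int (b (k, Some l))) :: real ^ 'd ^ 'm)"
  define Z where "Z = (\<Union>i. mk i ` F i)"
  have finF: "finite (F i)" for i unfolding F_def G_def by (rule finite_PiE) auto
  \<comment> \<open>Each of the m - 1 rows other than \<open>i\<close> contributes d entries and one
    coefficient, hence the factor d + 1 in \<open>N\<close>.\<close>
  have cardF: "card (F i) = card G ^ N" for i
    unfolding F_def N_def by (simp add: card_PiE card_cartesian_product mult.commute card_Diff_singleton)
  have G: "real (card G) * \<delta> \<le> 2 * K + 3"
    using card_ceiling_grid_le[of \<delta> K] assms unfolding G_def by simp
  have "card Z \<le> (\<Sum>i\<in>(UNIV::'m set). card (F i))"
    unfolding Z_def by (rule order_trans[OF card_UN_le]) (auto intro!: sum_mono card_image_le finF)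
  then have "real (card Z) \<le> real (CARD('m) * card G ^ N)" by (simp only: cardF of_nat_le_iff) simp
  then have "real (card Z) * \<delta> ^ N \<le> real CARD('m) * (real (card G) * \<delta>) ^ N"
    using mult_right_mono[of "real (card Z)" "real (CARD('m) * card G ^ N)" "\<delta> ^ N"] assms
    by (simp add: power_mult_distrib mult_ac)
  also have "\<dots> \<le> real CARD('m) * (2 * K + 3) ^ N"
    using G assms by (intro mult_left_mono power_mono) auto
  finally have card: "real (card Z) * \<delta> ^ N \<le> CARD('m) * (2 * K + 3) ^ N" .
  have approx: "\<exists>M\<in>Z. norm (A - M) \<le> CARD('m) * (CARD('d) * (CARD('m) * ((K + 2) * \<delta>)))"
    if ns: "\<not> surj ((*v) A)" and AK: "norm A \<le> K" for A :: "real ^ 'd ^ 'm"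
  proof -
    obtain c i where c: "c i = 1" "\<And>k. \<bar>c k\<bar> \<le> 1" "(\<Sum>k\<in>UNIV. c k *\<^sub>R A $ k) = 0"
      using not_surj_obtain_dependency[OF ns] by metis
    have entry: "\<bar>A $ k $ l\<bar> \<le> K" for k l
      by (rule order_trans[OF component_le_norm_cart order_trans[OF Finite_Cartesian_Product.norm_nth_le AK]])
    define b where "b = restrict (\<lambda>(k, t). \<lfloor>(case t of None \<Rightarrow> c k | Some l \<Rightarrow> A $ k $ l) / \<delta>\<rfloor>)
      ((UNIV - {i}) \<times> UNIV)"
    have bF: "b \<in> F i"
      unfolding F_def
    proof (rule PiE_I)
      fix p assume p: "p \<in> (UNIV - {i}) \<times> (UNIV :: 'd option set)"
      obtain k t where kt: "p = (k, t)" by (cases p)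
      \<comment> \<open>As \<open>1 \<le> K\<close>, the grid for the entries also holds the
        coefficients.\<close>
      have "\<bar>case t of None \<Rightarrow> c k | Some l \<Rightarrow> A $ k $ l\<bar> \<le> K"
        using entry order_trans[OF c(2) \<open>1 \<le> K\<close>] by (simp split: option.split)
      from floor_divide_grid_mem[OF \<open>0 < \<delta>\<close> this] show "b p \<in> G"
        using p unfolding b_def G_def kt restrict_def by simp
    qed (simp add: b_def)
    have "0 = (\<Sum>k\<in>UNIV. c k *\<^sub>R A $ k) $ l" for l using c(3) by simp
    then have Ai: "A $ i $ l = - (\<Sum>k\<in>UNIV - {i}. c k * A $ k $ l)" for l
      using c(1) by (simp add: sum.remove[of UNIV i] eq_neg_iff_add_eq_0)
    have "\<bar>(A - mk i b) $ k $ l\<bar> \<le> CARD('m) * ((K + 2) * \<delta>)" for k l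
    proof (cases "k = i")
      case False
      then have "\<bar>(A - mk i b) $ k $ l\<bar> \<le> \<delta>"
        using abs_diff_floor_grid[of \<delta> "A $ k $ l"] assms by (simp add: mk_def b_def)
      also have "\<dots> \<le> 1 * ((K + 2) * \<delta>)" using assms by simp
      also have "\<dots> \<le> CARD('m) * ((K + 2) * \<delta>)" using assms by (intro mult_right_mono) (auto simp: Suc_leI)
      finally show ?thesis .
    next
      case True
      let ?t = "\<lambda>k. (\<delta> * of_int (b (k, None))) * (\<delta> * of_int (b (k, Some l))) :: real"
      \<comment> \<open>Origin of \<open>K + 2\<close>: rounding the coefficient costs
        \<open>\<delta>\<close> times a rounded entry, which is at most \<open>K + 1\<close>, and
        rounding the entry costs another \<open>\<delta>\<close>.\<close>
      have trm: "\<bar>?t k - c k * A $ k $ l\<bar> \<le> (K + 2) * \<delta>" if "k \<noteq> i" for k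
      proof -
        let ?c = "\<delta> * of_int \<lfloor>c k / \<delta>\<rfloor>" and ?a = "\<delta> * of_int \<lfloor>A $ k $ l / \<delta>\<rfloor>"
        have 1: "\<bar>c k - ?c\<bar> \<le> \<delta>" "\<bar>A $ k $ l - ?a\<bar> \<le> \<delta>"
          using abs_diff_floor_grid assms by auto
        then have "\<bar>?a\<bar> \<le> K + 1" using entry[of k l] assms by linarith
        have "\<bar>?c * ?a - c k * A $ k $ l\<bar> = \<bar>(c k - ?c) * ?a + c k * (A $ k $ l - ?a)\<bar>"
          by (simp add: algebra_simps abs_minus_commute)
        also have "\<dots> \<le> \<bar>c k - ?c\<bar> * \<bar>?a\<bar> + \<bar>c k\<bar> * \<bar>A $ k $ l - ?a\<bar>"
          by (simp add: order_trans[OF abs_triangle_ineq] abs_mult)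
        also have "\<dots> \<le> \<delta> * (K + 1) + 1 * \<delta>"
          using 1 \<open>\<bar>?a\<bar> \<le> K + 1\<close> c(2) assms by (intro add_mono mult_mono) auto
        finally show ?thesis using that by (simp add: b_def algebra_simps)
      qed
      have "\<bar>(A - mk i b) $ k $ l\<bar> = \<bar>\<Sum>k\<in>UNIV - {i}. ?t k - c k * A $ k $ l\<bar>"
        using True by (simp add: mk_def Ai sum_subtractf)
      also have "\<dots> \<le> (\<Sum>k\<in>UNIV - {i}. \<bar>?t k - c k * A $ k $ l\<bar>)" by (rule sum_abs)
      also have "\<dots> \<le> real (card (UNIV - {i})) * ((K + 2) * \<delta>)"
        using trm by (intro sum_bounded_above) auto
      also have "\<dots> \<le> CARD('m) * ((K + 2) * \<delta>)"
        using assms by (intro mult_right_mono) (auto simp: card_Diff_singleton)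
      finally show ?thesis .
    qed
    then have "norm (A - mk i b) \<le> CARD('m) * (CARD('d) * (CARD('m) * ((K + 2) * \<delta>)))"
      by (rule norm_matrix_le_entries)
    moreover have "mk i b \<in> Z" using bF unfolding Z_def by blast
    ultimately show ?thesis by blast
  qed
  show thesis
    by (rule that[OF _ card approx]) (auto simp: Z_def finF)
qed

text \<open>As \<open>c i = 1\<close>, coordinate \<open>i\<close> is determined by the others up to
  an error of order \<open>s\<close>. So over each cube of side \<open>s\<close> in the other m - 1
  coordinates one axis-parallel box suffices, although the slab itself may be oblique.\<close>

lemma slab_cover:
  fixes c :: "'m::finite \<Rightarrow> real" and s R :: real
  assumes "c i = 1" "\<And>k. \<bar>c k\<bar> \<le> 1" "0 < s" "0 \<le> R"
  obtains T :: "(real ^ 'm) set" where "T \<in> lmeasurable"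
    "{z. norm z \<le> R \<and> \<bar>\<Sum>k\<in>UNIV. c k * z $ k\<bar> \<le> s} \<subseteq> T"
    "measure lebesgue T \<le> 2 * CARD('m) * s * (2 * R + 3 * s) ^ (CARD('m) - 1)"
proof -
  define G where "G = {- \<lceil>R / s\<rceil>..\<lceil>R / s\<rceil>}"
  define F where "F = (PiE (UNIV - {i}) (\<lambda>_. G) :: ('m \<Rightarrow> int) set)"
  define w where "w = (\<lambda>b. \<Sum>k\<in>UNIV - {i}. c k * (s * of_int (b k)))"
  have w: "0 \<le> CARD('m) * s" using \<open>0 < s\<close> by simp
  \<comment> \<open>\<open>- w b\<close> is the value of coordinate \<open>i\<close> that makes the
    sum vanish when the others sit at the corner of their cube. The half-height m s is made of
    \<open>s\<close> for the slab and \<open>s\<close> for each of the m - 1 rounded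
    coordinates.\<close>
  define bx where "bx = (\<lambda>b. cbox (\<chi> k. if k = i then - w b - CARD('m) * s else s * of_int (b k))
    (\<chi> k. if k = i then - w b + CARD('m) * s else s * of_int (b k) + s) :: (real ^ 'm) set)"
  have finF: "finite F" unfolding F_def G_def by (rule finite_PiE) auto
  have cardF: "card F = card G ^ (CARD('m) - 1)"
    unfolding F_def by (simp add: card_PiE card_Diff_singleton)
  have G: "real (card G) * s \<le> 2 * R + 3 * s"
    using card_ceiling_grid_le[of s R] assms unfolding G_def by simp
  have m_bx: "measure lebesgue (bx b) = 2 * CARD('m) * s * s ^ (CARD('m) - 1)" for b
  proof -
    have "measure lebesgue (bx b) = measure lborel (bx b)" by (simp add: bx_def)
    also have "\<dots> = (\<Prod>k\<in>UNIV. if k = i then 2 * CARD('m) * s else s)"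
      unfolding bx_def using \<open>0 < s\<close> w
      by (subst content_cbox_cart) (auto simp: interval_ne_empty_cart intro!: prod.cong)
    also have "\<dots> = 2 * CARD('m) * s * s ^ card (UNIV - {i})"
      by (subst prod.remove[of UNIV i]) auto
    finally show ?thesis by (simp add: card_Diff_singleton)
  qed
  show thesis
  proof
    show meas: "(\<Union>b\<in>F. bx b) \<in> lmeasurable"
      using finF by (intro fmeasurable.finite_UN) (auto simp: bx_def)
    show "{z. norm z \<le> R \<and> \<bar>\<Sum>k\<in>UNIV. c k * z $ k\<bar> \<le> s} \<subseteq> (\<Union>b\<in>F. bx b)"
    proof clarify
      fix z :: "real ^ 'm" assume z: "norm z \<le> R" "\<bar>\<Sum>k\<in>UNIV. c k * z $ k\<bar> \<le> s"
      define b where "b = restrict (\<lambda>k. \<lfloor>z $ k / s\<rfloor>) (UNIV - {i})"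
      have "\<bar>z $ k\<bar> \<le> R" for k using component_le_norm_cart[of z k] z(1) by linarith
      then have "b \<in> F"
        using \<open>0 < s\<close> by (auto simp: F_def b_def G_def PiE_iff simp del: atLeastAtMost_iff
            intro!: floor_divide_grid_mem)
      have cell: "s * of_int (b k) \<le> z $ k" "z $ k \<le> s * of_int (b k) + s" if "k \<noteq> i" for k
        using that floor_grid_bounds[OF \<open>0 < s\<close>, of "z $ k"] by (simp_all add: b_def)
      have "\<bar>\<Sum>k\<in>UNIV - {i}. c k * z $ k - c k * (s * of_int (b k))\<bar>
          \<le> (\<Sum>k\<in>UNIV - {i}. \<bar>c k * z $ k - c k * (s * of_int (b k))\<bar>)" by (rule sum_abs)
      also have "\<dots> \<le> real (card (UNIV - {i})) * s"
      proof (rule sum_bounded_above)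
        fix k assume "k \<in> UNIV - {i}"
        then have "\<bar>z $ k - s * of_int (b k)\<bar> \<le> s" using cell[of k] by auto
        then have "\<bar>c k\<bar> * \<bar>z $ k - s * of_int (b k)\<bar> \<le> 1 * s"
          using assms(2) by (intro mult_mono) auto
        then show "\<bar>c k * z $ k - c k * (s * of_int (b k))\<bar> \<le> s"
          by (simp add: abs_mult[symmetric] right_diff_distrib)
      qed
      also have "\<dots> = CARD('m) * s - s" by (simp add: card_Diff_singleton algebra_simps Suc_leI of_nat_diff)
      finally have "\<bar>(\<Sum>k\<in>UNIV - {i}. c k * z $ k) - w b\<bar> \<le> CARD('m) * s - s"
        by (simp add: w_def sum_subtractf)
      moreover have "\<bar>z $ i + (\<Sum>k\<in>UNIV - {i}. c k * z $ k)\<bar> \<le> s"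
        using z(2) by (simp add: sum.remove[of UNIV i] assms(1))
      ultimately have "\<bar>z $ i + w b\<bar> \<le> CARD('m) * s" by linarith
      then have "z \<in> bx b"
        using cell by (auto simp: bx_def mem_box_cart)
      then show "z \<in> (\<Union>b\<in>F. bx b)" using \<open>b \<in> F\<close> by blast
    qed
    have "measure lebesgue (\<Union>b\<in>F. bx b) \<le> (\<Sum>b\<in>F. measure lebesgue (bx b))"
      using finF by (intro measure_UNION_le) (auto simp: bx_def)
    also have "\<dots> = 2 * CARD('m) * s * (real (card G) * s) ^ (CARD('m) - 1)"
      by (simp add: m_bx cardF power_mult_distrib)
    also have "\<dots> \<le> 2 * CARD('m) * s * (2 * R + 3 * s) ^ (CARD('m) - 1)"
      using G assms by (intro mult_left_mono power_mono) auto
    finally show "measure lebesgue (\<Union>b\<in>F. bx b) \<le> 2 * CARD('m) * s * (2 * R + 3 * s) ^ (CARD('m) - 1)" .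
  qed
qed

subsection \<open>Measurability of the derivative events\<close>

lemma jacobian_eqI:
  fixes f :: "real ^ 'd::finite \<Rightarrow> real ^ 'm::finite"
  assumes "(f has_derivative (\<lambda>h. A *v h)) (at x)"
  shows "jacobian f (at x) = A"
  by (simp add: jacobian_def frechet_derivative_at[OF assms, symmetric])

text \<open>The right-hand side only involves countable operations on closed conditions, which makes
  differentiability at a point a Borel event.\<close>

lemma differentiable_jacobian_cball_iff:
  fixes f :: "real ^ 'd::finite \<Rightarrow> real ^ 'm::finite"
  assumes D: "D \<subseteq> cball M\<^sub>0 r" "cball M\<^sub>0 r \<subseteq> closure D"
  shows "f differentiable at x \<and> norm (jacobian f (at x) - M\<^sub>0) \<le> r \<longleftrightarrow>
    (\<forall>n. \<exists>k. \<exists>M\<in>D. \<forall>h. norm h \<le> 1 / real (Suc k) \<longrightarrow>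
       norm (f (x + h) - f x - M *v h) \<le> 1 / real (Suc n) * norm h)" (is "?L \<longleftrightarrow> ?R")
proof
  assume L: ?L
  let ?J = "jacobian f (at x)"
  have der: "(f has_derivative (\<lambda>h. ?J *v h)) (at x)" using L jacobian_works by blast
  show ?R
  proof
    fix n
    define e where "e = 1 / (2 * real (Suc n))"
    have "e > 0" by (simp add: e_def)
    have "?J \<in> closure D" using L D by (auto simp: dist_norm norm_minus_commute)
    then obtain M where M: "M \<in> D" "dist M ?J < e" using \<open>e > 0\<close> closure_approachable by blast
    obtain d where d: "d > 0" "\<And>y. norm (y - x) < d \<Longrightarrow>
        norm (f y - f x - ?J *v (y - x)) \<le> e * norm (y - x)"
      using der \<open>e > 0\<close> unfolding has_derivative_at_alt by meson
    obtain k where k: "1 / real (Suc k) < d"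
      using d(1) nat_approx_posE by blast
    have "norm (f (x + h) - f x - M *v h) \<le> 1 / real (Suc n) * norm h"
      if "norm h \<le> 1 / real (Suc k)" for h
    proof -
      have "f (x + h) - f x - M *v h = (f (x + h) - f x - ?J *v h) + (?J - M) *v h"
        by (simp add: matrix_vector_mult_diff_rdistrib)
      also have "norm \<dots> \<le> norm (f (x + h) - f x - ?J *v h) + norm ((?J - M) *v h)"
        by (rule norm_triangle_ineq)
      also have "\<dots> \<le> e * norm h + e * norm h"
      proof (rule add_mono)
        show "norm (f (x + h) - f x - ?J *v h) \<le> e * norm h"
          using d(2)[of "x + h"] that k by simp
        have "norm (?J - M) \<le> e" using M(2) by (simp add: dist_norm norm_minus_commute)
        then show "norm ((?J - M) *v h) \<le> e * norm h"
          by (meson norm_matrix_vector_mult_le mult_right_mono norm_ge_zero order_trans)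
      qed
      also have "\<dots> = 1 / real (Suc n) * norm h" by (simp add: e_def divide_simps)
      finally show ?thesis .
    qed
    then show "\<exists>k. \<exists>M\<in>D. \<forall>h. norm h \<le> 1 / real (Suc k) \<longrightarrow>
       norm (f (x + h) - f x - M *v h) \<le> 1 / real (Suc n) * norm h" using M(1) by blast
  qed
next
  assume ?R
  then obtain k M where M: "\<And>n. M n \<in> D" and
    kM: "\<And>n h. norm h \<le> 1 / real (Suc (k n)) \<Longrightarrow>
       norm (f (x + h) - f x - M n *v h) \<le> 1 / real (Suc n) * norm h" by metis
  have "\<forall>n. M n \<in> cball M\<^sub>0 r" using M D(1) by blast
  \<comment> \<open>Compactness of the ball turns the candidate matrices, one for each tolerance,
    into a single limit, which is then shown to be the derivative.\<close>
  then obtain A \<rho> where A: "A \<in> cball M\<^sub>0 r" "strict_mono \<rho>" "(M \<circ> \<rho>) \<longlonglongrightarrow> A"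
    using compact_cball[of M\<^sub>0 r] unfolding compact_def by meson
  have "(f has_derivative (\<lambda>h. A *v h)) (at x)"
    unfolding has_derivative_at_alt
  proof (intro conjI allI impI)
    show "bounded_linear (\<lambda>h. A *v h)" by (rule matrix_vector_mul_bounded_linear)
    fix e :: real assume "e > 0"
    then have "\<forall>\<^sub>F n in sequentially. dist ((M \<circ> \<rho>) n) A < e / 2"
      using tendstoD[OF A(3), of "e / 2"] by simp
    moreover obtain n0 where n0: "1 / real (Suc n0) < e / 2"
      using \<open>e > 0\<close> nat_approx_posE[of "e / 2"] by auto
    ultimately obtain n where n: "dist (M (\<rho> n)) A < e / 2" "n \<ge> n0"
      unfolding eventually_sequentially by (metis comp_apply max.cobounded1 max.cobounded2)
    \<comment> \<open>One index has to serve twice: \<open>M (\<rho> n)\<close> is close to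
      \<open>A\<close>, and its own tolerance \<open>1 / real (Suc (\<rho> n))\<close> is
      small.\<close>
    have "n0 \<le> \<rho> n" using n(2) seq_suble[OF A(2), of n] by linarith
    then have "1 / real (Suc (\<rho> n)) \<le> 1 / real (Suc n0)" by (simp add: frac_le)
    then have small: "1 / real (Suc (\<rho> n)) \<le> e / 2" using n0 by linarith
    show "\<exists>d>0. \<forall>y. norm (y - x) < d \<longrightarrow> norm (f y - f x - A *v (y - x)) \<le> e * norm (y - x)"
    proof (intro exI conjI allI impI)
      show "0 < 1 / real (Suc (k (\<rho> n)))" by simp
      fix y assume y: "norm (y - x) < 1 / real (Suc (k (\<rho> n)))"
      let ?h = "y - x"
      have "f y - f x - A *v ?h = (f (x + ?h) - f x - M (\<rho> n) *v ?h) + (M (\<rho> n) - A) *v ?h"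
        by (simp add: matrix_vector_mult_diff_rdistrib)
      also have "norm \<dots> \<le> norm (f (x + ?h) - f x - M (\<rho> n) *v ?h) + norm ((M (\<rho> n) - A) *v ?h)"
        by (rule norm_triangle_ineq)
      also have "\<dots> \<le> e / 2 * norm ?h + e / 2 * norm ?h"
      proof (rule add_mono)
        have "norm (f (x + ?h) - f x - M (\<rho> n) *v ?h) \<le> 1 / real (Suc (\<rho> n)) * norm ?h"
          using kM[of ?h "\<rho> n"] y by simp
        also have "\<dots> \<le> e / 2 * norm ?h" using small by (rule mult_right_mono) simp
        finally show "norm (f (x + ?h) - f x - M (\<rho> n) *v ?h) \<le> e / 2 * norm ?h" .
        have "norm (M (\<rho> n) - A) \<le> e / 2" using n(1) by (simp add: dist_norm)
        then show "norm ((M (\<rho> n) - A) *v ?h) \<le> e / 2 * norm ?h"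
          by (meson norm_matrix_vector_mult_le mult_right_mono norm_ge_zero order_trans)
      qed
      finally show "norm (f y - f x - A *v ?h) \<le> e * norm ?h" by simp
    qed
  qed
  then have "f differentiable at x" "jacobian f (at x) = A"
    using jacobian_eqI differentiable_def by blast+
  then show ?L using A(1) by (simp add: dist_norm norm_minus_commute)
qed

lemma continuous_on_eval_bcontfun: "continuous_on UNIV (\<lambda>\<phi>. apply_bcontfun \<phi> p)"
  unfolding continuous_on_iff by (meson dist_bounded le_less_trans)

text \<open>Makes the events of (b) Borel, so that they enter union bounds and integrals. In the
  supremum topology the derivative is not a continuous function of \<open>\<phi>\<close>; only point
  evaluations are.\<close>

lemma borel_differentiable_jacobian_cball:
  "{\<phi> :: 'd::finite torus \<Rightarrow>\<^sub>C (real ^ 'm::finite). torus_differentiable (apply_bcontfun \<phi>) p \<and>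
     norm (torus_jacobian (apply_bcontfun \<phi>) p - M\<^sub>0) \<le> r} \<in> sets borel" (is "?E \<in> _")
proof -
  obtain D where D: "countable D" "D \<subseteq> cball M\<^sub>0 r" "cball M\<^sub>0 r \<subseteq> closure D"
    using separable by blast
  let ?f = "\<lambda>\<phi> :: 'd torus \<Rightarrow>\<^sub>C (real ^ 'm). torus_lift (apply_bcontfun \<phi>)"
  let ?x = "rep_torus p"
  define C where "C = (\<lambda>n k M. {\<phi>. \<forall>h. norm h \<le> 1 / real (Suc k) \<longrightarrow>
       norm (?f \<phi> (?x + h) - ?f \<phi> ?x - M *v h) \<le> 1 / real (Suc n) * norm h})"
  have cont: "continuous_on UNIV (\<lambda>\<phi>. ?f \<phi> y)" for y
    unfolding torus_lift_def o_def by (rule continuous_on_eval_bcontfun)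
  \<comment> \<open>The uncountable quantifier over \<open>h\<close> is harmless here, since it only
    intersects closed conditions on two point evaluations. What remains outside is
    countable.\<close>
  have "closed (C n k M)" for n k M
    unfolding C_def
    by (intro closed_Collect_all closed_Collect_imp closed_Collect_le continuous_intros cont) auto
  then have "(\<Inter>n. \<Union>k. \<Union>M\<in>D. C n k M) \<in> sets borel"
    using D(1) by (intro sets.countable_INT sets.countable_UN sets.countable_UN' image_subsetI borel_closed) auto
  moreover have "?E = (\<Inter>n. \<Union>k. \<Union>M\<in>D. C n k M)"
    unfolding torus_differentiable_def torus_jacobian_def
      differentiable_jacobian_cball_iff[OF D(2,3)] C_def by auto
  ultimately show ?thesis by simp
qed

subsection \<open>Covering the critical values\<close>

text \<open>One constant controls both the size and the Hoelder modulus of the derivative, so that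
  for a nonnegative exponent the classes with natural constants exhaust all Hoelder
  functions.\<close>

definition torus_C1_holder_bound :: "real \<Rightarrow> real \<Rightarrow> ('d::finite torus \<Rightarrow> real ^ 'm::finite) \<Rightarrow> bool"
  where "torus_C1_holder_bound \<alpha> K g \<longleftrightarrow>
    (\<forall>x. torus_lift g differentiable at x) \<and>
    (\<forall>x. norm (jacobian (torus_lift g) (at x)) \<le> K) \<and>
    (\<forall>x y. norm (jacobian (torus_lift g) (at x) - jacobian (torus_lift g) (at y))
             \<le> K * dist x y powr \<alpha>)"

section \<open>The dyadic grid on the torus\<close>

definition torus_grid :: "nat \<Rightarrow> ('d::finite \<Rightarrow> nat) set"
  where "torus_grid n = PiE UNIV (\<lambda>_. {..<2 ^ n})"

definition grid_point :: "nat \<Rightarrow> ('d::finite \<Rightarrow> nat) \<Rightarrow> real ^ 'd"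
  where "grid_point n q = (\<chi> i. real (q i) / 2 ^ n)"

definition grid_cell :: "nat \<Rightarrow> ('d::finite \<Rightarrow> nat) \<Rightarrow> (real ^ 'd) set"
  where "grid_cell n q = cbox (grid_point n q) (\<chi> i. (real (q i) + 1) / 2 ^ n)"

lemma finite_torus_grid: "finite (torus_grid n)"
  unfolding torus_grid_def by (rule finite_PiE) auto

lemma card_torus_grid: "card (torus_grid n :: ('d::finite \<Rightarrow> nat) set) = (2 ^ n) ^ CARD('d)"
  by (simp add: torus_grid_def card_PiE)

lemma grid_cell_dist:
  fixes x y :: "real ^ 'd::finite"
  assumes "x \<in> grid_cell n q" "y \<in> grid_cell n q"
  shows "dist x y \<le> CARD('d) * (1 / 2 ^ n)"
proof -
  have "\<bar>(x - y) $ i\<bar> \<le> 1 / 2 ^ n" for i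
  proof -
    have "real (q i) / 2 ^ n \<le> x $ i" "x $ i \<le> real (q i) / 2 ^ n + 1 / 2 ^ n"
      "real (q i) / 2 ^ n \<le> y $ i" "y $ i \<le> real (q i) / 2 ^ n + 1 / 2 ^ n"
      using assms by (auto simp: grid_cell_def grid_point_def mem_box_cart add_divide_distrib)
    then show ?thesis unfolding vector_minus_component by linarith
  qed
  then have "(\<Sum>i\<in>UNIV. \<bar>(x - y) $ i\<bar>) \<le> CARD('d) * (1 / 2 ^ n)"
    by (intro sum_bounded_above) auto
  then show ?thesis using norm_le_l1_cart[of "x - y"] unfolding dist_norm by linarith
qed

lemma grid_point_in_cell: "grid_point n q \<in> grid_cell n q"
  by (auto simp: grid_cell_def grid_point_def mem_box_cart divide_right_mono)

lemma torus_grid_cell_exists: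
  fixes x :: "real ^ 'd::finite"
  obtains q p where "q \<in> torus_grid n" "p \<in> grid_cell n q" "to_torus p = to_torus x"
proof -
  define p where "p = (\<chi> i. frac (x $ i))"
  define q where "q = (\<lambda>i. nat \<lfloor>2 ^ n * (p $ i)\<rfloor>)"
  have p01: "0 \<le> p $ i" "p $ i < 1" for i by (auto simp: p_def frac_lt_1)
  have q: "real (q i) \<le> 2 ^ n * (p $ i)" "2 ^ n * (p $ i) \<le> real (q i) + 1" for i
  proof -
    have "0 \<le> 2 ^ n * (p $ i)" using p01 by simp
    then have "real (q i) = of_int \<lfloor>2 ^ n * (p $ i)\<rfloor>" by (simp add: q_def)
    then show "real (q i) \<le> 2 ^ n * (p $ i)" "2 ^ n * (p $ i) \<le> real (q i) + 1" by linarith+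
  qed
  have "real (q i) < 2 ^ n" for i
  proof -
    have "2 ^ n * p $ i < 2 ^ n * 1" using p01(2) by (intro mult_strict_left_mono) auto
    then show ?thesis using q(1)[of i] by linarith
  qed
  then have "q i < 2 ^ n" for i by (metis of_nat_less_iff of_nat_numeral of_nat_power)
  then have "q \<in> torus_grid n" by (simp add: torus_grid_def PiE_iff)
  moreover have "p \<in> grid_cell n q"
    using q by (auto simp: grid_cell_def grid_point_def mem_box_cart field_simps)
  moreover have "to_torus p = to_torus x"
    by (auto simp: torus.abs_eq_iff p_def frac_def)
  ultimately show thesis by (rule that)
qed

lemma torus_lift_eqI: "to_torus x = to_torus y \<Longrightarrow> torus_lift g x = torus_lift g y"
  by (simp add: torus_lift_def)

lemma jacobian_torus_lift_eqI:
  fixes g :: "'d::finite torus \<Rightarrow> real ^ 'm::finite"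
  assumes "to_torus x = to_torus y"
  shows "jacobian (torus_lift g) (at x) = jacobian (torus_lift g) (at y)"
  by (metis assms torus_jacobian_to_torus)

text \<open>By periodicity every value of the Jacobian occurs in the unit cube, where the Hoelder
  condition compares it with the value at 0. The form \<open>Suc K\<close> makes the constants
  countable and at least 1.\<close>

lemma torus_C1_holder_imp_bound:
  fixes g :: "'d::finite torus \<Rightarrow> real ^ 'm::finite"
    and \<alpha> :: real
  assumes "torus_C1_holder \<alpha> g" "0 \<le> \<alpha>"
  obtains K :: nat where "torus_C1_holder_bound \<alpha> (real (Suc K)) g"
proof -
  let ?J = "\<lambda>x. jacobian (torus_lift g) (at x)"
  obtain K0 where K0: "\<And>x y. norm (?J x - ?J y) \<le> K0 * dist x y powr \<alpha>"
    using assms(1) unfolding torus_C1_holder_def torus_jacobian_to_torus by blast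
  have diff: "torus_lift g differentiable at x" for x
    using assms(1) unfolding torus_C1_holder_def by (metis torus_differentiable_to_torus)
  define B where "B = norm (?J 0) + \<bar>K0\<bar> * real CARD('d) powr \<alpha>"
  have B: "norm (?J x) \<le> B" for x
  proof -
    obtain q and p :: "real ^ 'd" where q: "q \<in> torus_grid 0" "p \<in> grid_cell 0 q" "to_torus p = to_torus x"
      by (rule torus_grid_cell_exists)
    \<comment> \<open>At level 0 the grid has a single cell, the unit cube.\<close>
    have "grid_point 0 q = 0" using q(1) by (simp add: torus_grid_def grid_point_def PiE_iff vec_eq_iff)
    then have "dist p 0 \<le> CARD('d)"
      using grid_cell_dist[OF q(2) grid_point_in_cell] by simp
    then have "dist p 0 powr \<alpha> \<le> real CARD('d) powr \<alpha>"
      using assms(2) by (intro powr_mono2) auto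
    then have "K0 * dist p 0 powr \<alpha> \<le> \<bar>K0\<bar> * real CARD('d) powr \<alpha>"
      by (intro mult_mono) auto
    then have "norm (?J p - ?J 0) \<le> \<bar>K0\<bar> * real CARD('d) powr \<alpha>" using K0[of p 0] by linarith
    then have "norm (?J p) \<le> B" unfolding B_def using norm_triangle_ineq2[of "?J p" "?J 0"] by linarith
    then show ?thesis using jacobian_torus_lift_eqI[OF q(3), of g] by simp
  qed
  obtain K where K: "max B K0 \<le> real K" using real_arch_simple by blast
  have "torus_C1_holder_bound \<alpha> (real (Suc K)) g"
    unfolding torus_C1_holder_bound_def
  proof (intro conjI allI diff)
    fix x y show "norm (?J x) \<le> real (Suc K)" using B[of x] K by simp
    have "K0 * dist x y powr \<alpha> \<le> real (Suc K) * dist x y powr \<alpha>"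
      using K by (intro mult_right_mono) auto
    then show "norm (?J x - ?J y) \<le> real (Suc K) * dist x y powr \<alpha>" using K0[of x y] by linarith
  qed
  then show thesis by (rule that)
qed

section \<open>Images of critical points\<close>

text \<open>Mean value inequality for \<open>f\<close> minus its linear part at \<open>x\<close>:
  along the segment the derivative of this difference is \<open>?J z - ?J x\<close>, which the
  Hoelder condition bounds.\<close>

lemma holder_taylor:
  fixes f :: "real ^ 'd::finite \<Rightarrow> real ^ 'm::finite"
    and \<alpha> K :: real
  assumes diff: "\<And>x. f differentiable at x" and "0 \<le> \<alpha>" "0 \<le> K"
    and holder: "\<And>x y. norm (jacobian f (at x) - jacobian f (at y)) \<le> K * dist x y powr \<alpha>"
  shows "norm (f y - f x - jacobian f (at x) *v (y - x)) \<le> K * norm (y - x) powr \<alpha> * norm (y - x)"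
proof -
  let ?J = "\<lambda>x. jacobian f (at x)"
  have "norm ((\<lambda>z. f z - ?J x *v z) y - (\<lambda>z. f z - ?J x *v z) x) \<le> K * norm (y - x) powr \<alpha> * norm (y - x)"
  proof (rule differentiable_bound[of "closed_segment x y" _ "\<lambda>z h. (?J z - ?J x) *v h"])
    fix z assume z: "z \<in> closed_segment x y"
    have "(f has_derivative (\<lambda>h. ?J z *v h)) (at z)" using diff jacobian_works by blast
    then have "((\<lambda>z. f z - ?J x *v z) has_derivative (\<lambda>h. ?J z *v h - ?J x *v h)) (at z)"
      by (intro has_derivative_diff bounded_linear_imp_has_derivative) auto
    then show "((\<lambda>z. f z - ?J x *v z) has_derivative (\<lambda>h. (?J z - ?J x) *v h)) (at z within closed_segment x y)"
      by (simp add: matrix_vector_mult_diff_rdistrib has_derivative_at_withinI)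
    have "dist z x \<le> norm (y - x)"
      using z segment_bound1[of z x y] by (simp add: dist_norm norm_minus_commute)
    then have "K * dist z x powr \<alpha> \<le> K * norm (y - x) powr \<alpha>"
      using assms by (intro mult_left_mono powr_mono2) auto
    then have "norm (?J z - ?J x) \<le> K * norm (y - x) powr \<alpha>" using holder[of z x] by linarith
    then show "onorm (\<lambda>h. (?J z - ?J x) *v h) \<le> K * norm (y - x) powr \<alpha>"
      by (intro onorm_le order_trans[OF norm_matrix_vector_mult_le] mult_right_mono) auto
  qed auto
  then show ?thesis by (simp add: matrix_vector_mult_diff_distrib algebra_simps)
qed

text \<open>The image of the ball stays within \<open>R\<close>, of order \<open>\<rho>\<close>, of
  \<open>f x\<close>, and within \<open>s\<close>, of order
  \<open>\<rho> powr (1 + \<alpha>)\<close>, of a hyperplane through \<open>f x\<close>. The slab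
  volume s R^(m-1) gives the exponent m + \<open>\<alpha>\<close>. The upper bound \<open>L\<close>
  makes the constant independent of \<open>\<rho>\<close>.\<close>

lemma critical_image_cover:
  fixes f :: "real ^ 'd::finite \<Rightarrow> real ^ 'm::finite"
    and \<alpha> K \<rho> L :: real
  assumes diff: "\<And>x. f differentiable at x" and "0 < \<alpha>" "1 \<le> K"
    and holder: "\<And>x y. norm (jacobian f (at x) - jacobian f (at y)) \<le> K * dist x y powr \<alpha>"
    and bound: "norm (jacobian f (at x)) \<le> K"
    and crit: "\<not> surj ((*v) (jacobian f (at x)))"
    and \<rho>: "0 < \<rho>" "\<rho> \<le> L"
  obtains T where "T \<in> lmeasurable" "f ` cball x \<rho> \<subseteq> T"
    "measure lebesgue T \<le>
       2 * CARD('m) * (CARD('m) * K) * (5 * (CARD('m) * K) * (1 + L powr \<alpha>)) ^ (CARD('m) - 1)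
         * \<rho> powr (CARD('m) + \<alpha>)"
proof -
  let ?J = "jacobian f (at x)"
  define m where "m = real CARD('m)"
  define s where "s = m * K * (\<rho> powr \<alpha> * \<rho>)"
  define R where "R = K * \<rho> + K * (\<rho> powr \<alpha> * \<rho>)"
  have m: "1 \<le> m" by (simp add: m_def Suc_leI)
  have s: "0 < s" and R: "0 \<le> R" using assms m by (auto simp: s_def R_def)
  obtain c i where c: "c i = 1" "\<And>k. \<bar>c k\<bar> \<le> 1" "(\<Sum>k\<in>UNIV. c k *\<^sub>R ?J $ k) = 0"
    using not_surj_obtain_dependency[OF crit] by metis
  obtain T where T: "T \<in> lmeasurable" "{z. norm z \<le> R \<and> \<bar>\<Sum>k\<in>UNIV. c k * z $ k\<bar> \<le> s} \<subseteq> T"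
    "measure lebesgue T \<le> 2 * CARD('m) * s * (2 * R + 3 * s) ^ (CARD('m) - 1)"
    by (rule slab_cover[where c = c, OF c(1) c(2) s R])
  show thesis
  proof
    show "(+) (f x) ` T \<in> lmeasurable" using T(1) by (rule measurable_translation)
    show "f ` cball x \<rho> \<subseteq> (+) (f x) ` T"
    proof clarify
      fix y assume "y \<in> cball x \<rho>"
      then have y: "norm (y - x) \<le> \<rho>" by (simp add: dist_norm norm_minus_commute)
      define e where "e = f y - f x - ?J *v (y - x)"
      have "norm e \<le> K * norm (y - x) powr \<alpha> * norm (y - x)"
        unfolding e_def using assms by (intro holder_taylor) auto
      also have "\<dots> \<le> K * \<rho> powr \<alpha> * \<rho>"
        using y assms by (intro mult_mono powr_mono2) auto
      finally have e: "norm e \<le> K * (\<rho> powr \<alpha> * \<rho>)" by (simp add: mult.assoc)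
      have "norm (?J *v (y - x)) \<le> K * \<rho>"
        by (rule order_trans[OF norm_matrix_vector_mult_le]) (use y bound assms in \<open>intro mult_mono; simp\<close>)
      then have "norm (f y - f x) \<le> R"
        using norm_triangle_ineq[of e "?J *v (y - x)"] e by (simp add: e_def R_def)
      moreover have "\<bar>\<Sum>k\<in>UNIV. c k * (f y - f x) $ k\<bar> \<le> s"
      proof -
        \<comment> \<open>Pairing with \<open>c\<close> kills the linear part, because
          \<open>c\<close> is a dependency of the rows of \<open>?J\<close>.\<close>
        have "(\<Sum>k\<in>UNIV. c k * (?J *v (y - x)) $ k) = (\<Sum>k\<in>UNIV. c k *\<^sub>R ?J $ k) \<bullet> (y - x)"
          by (simp add: inner_sum_left matrix_vector_mul_component)
        then have "(\<Sum>k\<in>UNIV. c k * (f y - f x) $ k) = (\<Sum>k\<in>UNIV. c k * e $ k)"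
          using c(3) by (simp add: e_def right_diff_distrib sum_subtractf)
        moreover have "\<bar>\<Sum>k\<in>UNIV. c k * e $ k\<bar> \<le> (\<Sum>k\<in>UNIV. \<bar>c k * e $ k\<bar>)" by (rule sum_abs)
        moreover have "\<dots> \<le> m * norm e"
          unfolding m_def
        proof (rule sum_bounded_above)
          fix k show "\<bar>c k * e $ k\<bar> \<le> norm e"
            using mult_mono[OF c(2)[of k] component_le_norm_cart[of e k]] by (simp add: abs_mult)
        qed
        moreover have "m * norm e \<le> s"
          using mult_left_mono[OF e, of m] m by (simp add: s_def mult.assoc)
        ultimately show ?thesis by linarith
      qed
      ultimately have "f y - f x \<in> T" using T(2) by blast
      then show "f y \<in> (+) (f x) ` T" by (rule rev_image_eqI) simp
    qed
    \<comment> \<open>With \<open>\<rho> powr \<alpha> \<le> L powr \<alpha>\<close> both terms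
      become linear in \<open>\<rho>\<close>; the 5 is 2 + 3.\<close>
    have "2 * R + 3 * s \<le> 5 * (m * K) * (1 + L powr \<alpha>) * \<rho>"
    proof -
      have "\<rho> powr \<alpha> \<le> L powr \<alpha>" using \<rho> assms by (intro powr_mono2) auto
      then have *: "\<rho> powr \<alpha> * \<rho> \<le> L powr \<alpha> * \<rho>" using \<rho> by (intro mult_right_mono) auto
      have "K \<le> m * K" using m assms mult_right_mono[of 1 m K] by simp
      then have "R \<le> m * K * \<rho> + m * K * (L powr \<alpha> * \<rho>)"
        unfolding R_def using * \<rho> assms by (intro add_mono mult_mono) auto
      moreover have "s \<le> m * K * (L powr \<alpha> * \<rho>)"
        unfolding s_def using * m assms by (intro mult_left_mono) auto
      moreover have "0 \<le> m * K * \<rho>" using m \<rho> assms by simp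
      ultimately show ?thesis by (simp add: algebra_simps)
    qed
    then have "(2 * R + 3 * s) ^ (CARD('m) - 1) \<le> (5 * (m * K) * (1 + L powr \<alpha>) * \<rho>) ^ (CARD('m) - 1)"
      using R s by (intro power_mono) auto
    then have "measure lebesgue T \<le> 2 * CARD('m) * s * (5 * (m * K) * (1 + L powr \<alpha>) * \<rho>) ^ (CARD('m) - 1)"
      using T(3) mult_left_mono[of _ _ "2 * CARD('m) * s"] s by (meson less_imp_le mult_nonneg_nonneg of_nat_0_le_iff order_trans zero_le_numeral)
    also have "\<dots> = 2 * CARD('m) * (m * K) * (5 * (m * K) * (1 + L powr \<alpha>)) ^ (CARD('m) - 1)
         * (\<rho> powr \<alpha> * (\<rho> * \<rho> ^ (CARD('m) - 1)))"
      unfolding s_def by (simp add: power_mult_distrib mult_ac)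
    also have "\<rho> powr \<alpha> * (\<rho> * \<rho> ^ (CARD('m) - 1)) = \<rho> powr (CARD('m) + \<alpha>)"
      using \<rho> by (simp add: powr_add powr_realpow mult.commute flip: power_Suc)
    finally show "measure lebesgue ((+) (f x) ` T) \<le>
       2 * CARD('m) * (CARD('m) * K) * (5 * (CARD('m) * K) * (1 + L powr \<alpha>)) ^ (CARD('m) - 1)
         * \<rho> powr (CARD('m) + \<alpha>)"
      by (simp add: m_def measure_translation)
  qed
qed

text \<open>Inside a cell the Jacobian varies by at most \<open>K\<close> times the
  \<open>\<alpha>\<close>-th power of the diameter bound d / 2^n, so a critical point anywhere in
  the cell shows at its corner, with the radius enlarged by this amount. The cells counted are thus
  selected by the Jacobian at one fixed point each.\<close>

lemma critical_values_cover:
  fixes g :: "'d::finite torus \<Rightarrow> real ^ 'm::finite"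
    and \<alpha> K r :: real
  assumes g: "torus_C1_holder_bound \<alpha> K g" and "0 < \<alpha>" "1 \<le> K"
    and net: "\<And>A :: real ^ 'd ^ 'm. \<not> surj ((*v) A) \<Longrightarrow> norm A \<le> K \<Longrightarrow> \<exists>M\<in>Z. norm (A - M) \<le> r"
  obtains T where "T \<in> lmeasurable"
    "torus_lift g ` {x. \<not> surj ((*v) (jacobian (torus_lift g) (at x)))} \<subseteq> T"
    "measure lebesgue T \<le>
       card {q\<in>torus_grid n. \<exists>M\<in>Z. norm (jacobian (torus_lift g) (at (grid_point n q)) - M)
               \<le> r + K * (CARD('d) * (1 / 2 ^ n)) powr \<alpha>}
       * (2 * CARD('m) * (CARD('m) * K) * (5 * (CARD('m) * K) * (1 + CARD('d) powr \<alpha>)) ^ (CARD('m) - 1)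
         * (CARD('d) * (1 / 2 ^ n)) powr (CARD('m) + \<alpha>))"
proof -
  let ?f = "torus_lift g"
  let ?J = "\<lambda>x. jacobian ?f (at x)"
  define \<rho> where "\<rho> = real CARD('d) * (1 / 2 ^ n)"
  define V where "V = 2 * CARD('m) * (CARD('m) * K) * (5 * (CARD('m) * K) * (1 + CARD('d) powr \<alpha>)) ^ (CARD('m) - 1)
         * \<rho> powr (CARD('m) + \<alpha>)"
  define Q where "Q = {q\<in>torus_grid n. \<exists>M\<in>Z. norm (?J (grid_point n q) - M) \<le> r + K * \<rho> powr \<alpha>}"
  have \<rho>: "0 < \<rho>" "\<rho> \<le> CARD('d)" by (auto simp: \<rho>_def divide_le_eq)
  have diff: "?f differentiable at x" and bound: "norm (?J x) \<le> K"
    and holder: "norm (?J x - ?J y) \<le> K * dist x y powr \<alpha>" for x y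
    using g unfolding torus_C1_holder_bound_def by blast+
  have V: "0 \<le> V" using assms by (simp add: V_def)
  have "\<forall>q. \<exists>T. T \<in> lmeasurable \<and> ?f ` {x\<in>grid_cell n q. \<not> surj ((*v) (?J x))} \<subseteq> T \<and> measure lebesgue T \<le> V"
  proof (rule allI)
    fix q show "\<exists>T. T \<in> lmeasurable \<and> ?f ` {x\<in>grid_cell n q. \<not> surj ((*v) (?J x))} \<subseteq> T \<and> measure lebesgue T \<le> V"
    proof (cases "\<exists>x\<in>grid_cell n q. \<not> surj ((*v) (?J x))")
      case True
      then obtain x where x: "x \<in> grid_cell n q" "\<not> surj ((*v) (?J x))" by blast
      obtain T where T: "T \<in> lmeasurable" "?f ` cball x \<rho> \<subseteq> T" "measure lebesgue T \<le> V"
        using critical_image_cover[OF diff \<open>0 < \<alpha>\<close> \<open>1 \<le> K\<close> holder bound x(2) \<rho>] unfolding V_def by metis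
      have "grid_cell n q \<subseteq> cball x \<rho>"
        using grid_cell_dist[OF x(1)] unfolding \<rho>_def by auto
      then have "?f ` {x\<in>grid_cell n q. \<not> surj ((*v) (?J x))} \<subseteq> T" using T(2) by auto
      with T(1,3) show ?thesis by (intro exI conjI)
    next
      case False
      then have "{x\<in>grid_cell n q. \<not> surj ((*v) (?J x))} = {}" by auto
      then show ?thesis using V by (intro exI[of _ "{}"]) simp
    qed
  qed
  from choice[OF this] obtain T where T': "\<forall>q. T q \<in> lmeasurable \<and>
      ?f ` {x\<in>grid_cell n q. \<not> surj ((*v) (?J x))} \<subseteq> T q \<and> measure lebesgue (T q) \<le> V" by (rule exE)
  have T: "\<And>q. T q \<in> lmeasurable"
    "\<And>q. ?f ` {x\<in>grid_cell n q. \<not> surj ((*v) (?J x))} \<subseteq> T q" "\<And>q. measure lebesgue (T q) \<le> V"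
    by (rule T'[rule_format, THEN conjunct1], rule T'[rule_format, THEN conjunct2, THEN conjunct1],
        rule T'[rule_format, THEN conjunct2, THEN conjunct2])
  have finQ: "finite Q" unfolding Q_def by (rule finite_subset[OF _ finite_torus_grid]) auto
  have "(\<Union>q\<in>Q. T q) \<in> lmeasurable" using finQ T(1) by (intro fmeasurable.finite_UN) auto
  moreover have "?f ` {x. \<not> surj ((*v) (?J x))} \<subseteq> (\<Union>q\<in>Q. T q)"
  proof clarify
    fix x assume x: "\<not> surj ((*v) (?J x))"
    obtain q p where q: "q \<in> torus_grid n" "p \<in> grid_cell n q" "to_torus p = to_torus x"
      by (rule torus_grid_cell_exists)
    have Jp: "?J p = ?J x" using q(3) by (rule jacobian_torus_lift_eqI)
    obtain M where M: "M \<in> Z" "norm (?J p - M) \<le> r" using net[of "?J p"] x bound Jp by auto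
    have "norm (?J (grid_point n q) - ?J p) \<le> K * dist (grid_point n q) p powr \<alpha>" by (rule holder)
    also have "\<dots> \<le> K * \<rho> powr \<alpha>"
      using grid_cell_dist[OF grid_point_in_cell q(2)] assms
      by (intro mult_left_mono powr_mono2) (auto simp: \<rho>_def)
    finally have "norm (?J (grid_point n q) - M) \<le> r + K * \<rho> powr \<alpha>"
      using M(2) norm_triangle_ineq[of "?J p - M" "?J (grid_point n q) - ?J p"] by simp
    then have "q \<in> Q" using q(1) M(1) unfolding Q_def by blast
    moreover have "?f x = ?f p" using q(3) by (intro torus_lift_eqI) simp
    moreover have "?f p \<in> T q" by (rule subsetD[OF T(2) imageI]) (use q(2) x Jp in simp)
    ultimately show "?f x \<in> (\<Union>q\<in>Q. T q)" by auto
  qed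
  moreover have "measure lebesgue (\<Union>q\<in>Q. T q) \<le> card Q * V"
  proof -
    have "measure lebesgue (\<Union>q\<in>Q. T q) \<le> (\<Sum>q\<in>Q. measure lebesgue (T q))"
      using finQ T(1) by (intro measure_UNION_le) auto
    also have "\<dots> \<le> card Q * V" using T(3) by (intro sum_bounded_above)
    finally show ?thesis .
  qed
  ultimately show thesis
    using that[of "\<Union>q\<in>Q. T q"] unfolding Q_def V_def \<rho>_def by blast
qed

subsection \<open>Regular fibres\<close>

text \<open>By Cramer's rule the entries of the inverse are quotients of determinants. This is what
  makes the inverse of a chart continuously differentiable.\<close>

lemma continuous_on_matrix_left_inverse:
  fixes A B :: "'a::topological_space \<Rightarrow> real ^ 'n::finite ^ 'n"
  assumes A: "continuous_on S A" and BA: "\<And>x. x \<in> S \<Longrightarrow> B x ** A x = mat 1"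
  shows "continuous_on S B"
proof -
  have det: "det (A x) \<noteq> 0" if "x \<in> S" for x
    using BA[OF that] invertible_det_nz invertible_left_inverse by blast
  have AB: "A x ** B x = mat 1" if "x \<in> S" for x
    using BA[OF that] matrix_left_right_inverse by blast
  have entry: "B x $ k $ l = det (\<chi> i j. if j = k then axis l 1 $ i else A x $ i $ j) / det (A x)"
    if "x \<in> S" for x k l
  proof -
    have "A x *v (B x *v axis l 1) = axis l 1"
      by (simp add: AB[OF that] matrix_vector_mul_assoc)
    then have "B x *v axis l 1 = (\<chi> k. det (\<chi> i j. if j = k then axis l 1 $ i else A x $ i $ j) / det (A x))"
      using cramer[OF det[OF that]] by blast
    then show ?thesis
      by (metis (no_types, lifting) column_def matrix_vector_mult_basis vec_lambda_beta)
  qed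
  have cA: "continuous_on S (\<lambda>x. A x $ i $ j)" for i j
    using A by (intro continuous_intros)
  have cdet: "continuous_on S (\<lambda>x. det (C x))" if "\<And>i j. continuous_on S (\<lambda>x. C x $ i $ j)"
    for C :: "'a \<Rightarrow> real ^ 'n ^ 'n"
    unfolding det_def by (intro continuous_on_sum continuous_on_mult continuous_on_const continuous_on_prod that)
  have "continuous_on S (\<lambda>x. B x $ k $ l)" for k l
  proof -
    have "continuous_on S (\<lambda>x. (\<chi> i j. if j = k then axis l 1 $ i else A x $ i $ j) $ i $ j)" for i j
      by (cases "j = k") (simp_all add: cA)
    then have "continuous_on S (\<lambda>x. det (\<chi> i j. if j = k then axis l 1 $ i else A x $ i $ j) / det (A x))"
      using cA det by (intro continuous_on_divide cdet) blast+
    then show ?thesis using entry by (simp cong: continuous_on_cong)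
  qed
  then have "continuous_on S (\<lambda>x. \<chi> k. \<chi> l. B x $ k $ l)" by (intro continuous_on_vec_lambda)
  then show ?thesis by simp
qed

text \<open>To the inverse function theorem this adds continuity of the Jacobian \<open>G\<close> of
  the local inverse \<open>g\<close>, from the identity
  \<open>G y ** H (g y) = mat 1\<close>.\<close>

lemma C1_local_diffeomorphism:
  fixes h :: "real ^ 'n::finite \<Rightarrow> real ^ 'n"
  assumes der: "\<And>x. (h has_derivative (\<lambda>v. H x *v v)) (at x)" and cont: "continuous_on UNIV H"
    and inj: "\<And>v. H x0 *v v = 0 \<Longrightarrow> v = 0" and "0 < r"
  obtains U V where "C1_diffeomorphism U V h" "x0 \<in> U" "U \<subseteq> ball x0 r"
proof -
  define f' where "f' x = Blinfun ((*v) (H x))" for x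
  have f': "blinfun_apply (f' x) = (*v) (H x)" for x
    unfolding f'_def by (simp add: bounded_linear_Blinfun_apply)
  obtain B where B: "B ** H x0 = mat 1"
    using inj matrix_left_invertible_ker by blast
  obtain U V g g' where U: "open U" "U \<subseteq> ball x0 r" "x0 \<in> U" "open V" "h x0 \<in> V" "homeomorphism U V h g"
    and g: "\<And>y. y \<in> V \<Longrightarrow> (g has_derivative (g' y)) (at y)"
      "\<And>y. y \<in> V \<Longrightarrow> g' y = inv (blinfun_apply (f'(g y)))"
      "\<And>y. y \<in> V \<Longrightarrow> bij (blinfun_apply (f'(g y)))"
  proof (rule inverse_function_theorem[of "ball x0 r" h f' x0 "Blinfun ((*v) B)"])
    show "(h has_derivative blinfun_apply (f' x)) (at x)" for x unfolding f' by (rule der)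
    show "continuous_on (ball x0 r) f'"
    proof (rule continuous_on_blinfun_componentwise)
      fix i :: "real ^ 'n"
      have "continuous_on UNIV (\<lambda>x. H x *v i)"
        unfolding matrix_vector_mult_def using cont by (intro continuous_intros)
      then show "continuous_on (ball x0 r) (\<lambda>x. blinfun_apply (f' x) i)"
        unfolding f' by (rule continuous_on_subset) auto
    qed
    show "Blinfun ((*v) B) o\<^sub>L f' x0 = id_blinfun"
      by (rule blinfun_eqI) (simp add: f' bounded_linear_Blinfun_apply matrix_vector_mul_assoc B)
  qed (use \<open>0 < r\<close> in auto)
  define G where "G y = matrix (g' y)" for y
  have gG: "(g has_derivative (\<lambda>v. G y *v v)) (at y)" if "y \<in> V" for y
    using g(1)[OF that] has_derivative_linear[OF g(1)[OF that]] by (simp add: G_def)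
  have "G y ** H (g y) = mat 1" if "y \<in> V" for y
  proof -
    have "G y *v (H (g y) *v v) = v" for v
      using g(2,3)[OF that] has_derivative_linear[OF g(1)[OF that]]
      by (simp add: G_def f' bij_is_inj inv_f_f)
    then show ?thesis by (simp add: matrix_eq matrix_vector_mul_assoc)
  qed
  moreover have "continuous_on V (\<lambda>y. H (g y))"
    using U(6) by (intro continuous_on_compose2[OF cont]) (auto simp: homeomorphism_def)
  ultimately have "continuous_on V G" by (rule continuous_on_matrix_left_inverse[rotated])
  moreover have "jacobian g (at y) = G y" if "y \<in> V" for y using gG[OF that] by (rule jacobian_eqI)
  ultimately have "C1_on V g"
    unfolding C1_on_def using g(1) by (auto simp: differentiable_def cong: continuous_on_cong)
  moreover have "C1_on U h"
    unfolding C1_on_def using der jacobian_eqI[OF der] continuous_on_subset[OF cont]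
    by (auto simp: differentiable_def cong: continuous_on_cong)
  ultimately have "C1_diffeomorphism U V h" unfolding C1_diffeomorphism_def using U by blast
  then show thesis using U(2,3) that by blast
qed

text \<open>Two points of the ball are less than 1 apart, so coordinates that differ by an integer
  agree.\<close>

lemma inj_on_to_torus_ball: "inj_on to_torus (ball (x :: real ^ 'd::finite) (1 / 2))"
proof (rule inj_onI)
  fix u v assume uv: "u \<in> ball x (1 / 2)" "v \<in> ball x (1 / 2)" "to_torus u = to_torus v"
  have "dist u v < 1" using uv(1,2) dist_triangle_half_r[of x u 1 v] by simp
  show "u = v"
  proof (rule vec_eq_iff[THEN iffD2, rule_format])
    fix i
    have "u $ i - v $ i \<in> \<int>" using uv(3) by (simp add: torus.abs_eq_iff)
    moreover have "\<bar>u $ i - v $ i\<bar> < 1"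
      using component_le_norm_cart[of "u - v" i] \<open>dist u v < 1\<close> by (simp add: dist_norm)
    ultimately show "u $ i = v $ i" using Ints_eq_abs_less1[of "u $ i - v $ i" 0] by simp
  qed
qed

text \<open>The kernel of \<open>A\<close> has dimension \<open>card I\<close>, hence is isomorphic
  to the coordinate subspace of \<open>I\<close>. Such an isomorphism, extended linearly, supplies
  the coordinates that \<open>A\<close> misses, for any choice of \<open>I\<close> of the right
  size.\<close>

lemma complement_coordinates:
  fixes A :: "real ^ 'd::finite ^ 'm::finite"
  assumes "surj ((*v) A)" "CARD('m) + card I = CARD('d)"
  obtains T :: "real ^ 'd \<Rightarrow> real ^ 'd" where "linear T" "\<forall>x i. i \<notin> I \<longrightarrow> T x $ i = 0"
    "\<forall>x. T x = 0 \<longrightarrow> A *v x = 0 \<longrightarrow> x = 0"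
proof -
  define Ker where "Ker = {x. A *v x = 0}"
  define W where "W = {z :: real ^ 'd. \<forall>i. i \<notin> I \<longrightarrow> z $ i = 0}"
  have "subspace Ker" unfolding Ker_def by (rule linear_subspace_kernel) simp
  have "A *v y = 0 \<longleftrightarrow> (\<forall>v\<in>span (rows A). orthogonal v y)" for y
  proof
    show "\<forall>v\<in>span (rows A). orthogonal v y" if "A *v y = 0"
      using that orthogonal_nullspace_rowspace by (metis orthogonal_commute)
    assume "\<forall>v\<in>span (rows A). orthogonal v y"
    then have "orthogonal (row i A) y" for i by (auto simp: rows_def intro!: span_base)
    then show "A *v y = 0"
      by (simp add: vec_eq_iff matrix_vector_mul_component orthogonal_def row_def)
  qed
  then have "Ker = {y\<in>UNIV. \<forall>v\<in>span (rows A). orthogonal v y}" by (simp add: Ker_def)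
  then have "dim Ker + dim (span (rows A)) = CARD('d)"
    using dim_subspace_orthogonal_to_vectors[of "span (rows A)" UNIV] by simp
  moreover have "dim (span (rows A)) = dim (range ((*v) A))"
    by (simp add: row_rank_def[symmetric] rank_dim_range)
  ultimately have "dim Ker + dim (range ((*v) A)) = CARD('d)" by simp
  then have "dim Ker = card I" using assms by simp
  moreover have "dim W = card I" unfolding W_def dim_vec_eq[symmetric] by (rule dim_substandard_cart)
  moreover have "subspace W" by (auto simp: W_def subspace_def)
  ultimately obtain f where f: "linear f" "f ` Ker = W" "inj_on f Ker"
    using subspace_isomorphism[OF \<open>subspace Ker\<close>, of W] by auto
  \<comment> \<open>The extension \<open>f\<close> may leave \<open>W\<close> off the kernel; the
    projection forces its values into \<open>W\<close> and changes nothing on the kernel.\<close>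
  define pr where "pr z = (\<chi> i. if i \<in> I then z $ i else 0)" for z :: "real ^ 'd"
  have pr: "linear pr" by (rule linearI) (auto simp: pr_def vec_eq_iff)
  show thesis
  proof
    show "linear (pr \<circ> f)" using f(1) pr by (rule linear_compose)
    show "\<forall>x i. i \<notin> I \<longrightarrow> (pr \<circ> f) x $ i = 0" by (simp add: pr_def)
    show "\<forall>x. (pr \<circ> f) x = 0 \<longrightarrow> A *v x = 0 \<longrightarrow> x = 0"
    proof (intro allI impI)
      fix x assume that: "(pr \<circ> f) x = 0" "A *v x = 0"
      have x: "x \<in> Ker" using that(2) by (simp add: Ker_def)
      then have "f x \<in> W" using f(2) by blast
      then have "pr (f x) = f x" by (auto simp: pr_def W_def vec_eq_iff)
      then have "f x = f 0" using that(1) linear_0[OF f(1)] by simp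
      then show "x = 0" using f(3) x unfolding Ker_def by (simp add: inj_on_def)
    qed
  qed
qed

text \<open>The chart \<open>h\<close> has a linear function of \<open>x - x0\<close> in the
  coordinates of \<open>I\<close> and \<open>?f x - y\<close> in the others, so the fibre is where
  the latter vanish. At \<open>x0\<close> its derivative is injective: a vector that it kills lies
  in the kernel of the Jacobian, where \<open>T\<close> is injective.\<close>

lemma regular_value_submanifold:
  fixes g :: "'d::finite torus \<Rightarrow> real ^ 'm::finite"
  assumes diff: "\<And>x. torus_lift g differentiable at x"
    and cont: "continuous_on UNIV (\<lambda>x. jacobian (torus_lift g) (at x))"
    and reg: "\<And>x. torus_lift g x = y \<Longrightarrow> surj ((*v) (jacobian (torus_lift g) (at x)))"
    and card: "CARD('m) + j = CARD('d)"
  shows "torus_C1_submanifold j (g -` {y})"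
  unfolding torus_C1_submanifold_def
proof
  fix p assume "p \<in> g -` {y}"
  define x0 where "x0 = rep_torus p"
  let ?f = "torus_lift g"
  let ?J = "\<lambda>x. jacobian ?f (at x)"
  have x0: "to_torus x0 = p" by (simp add: x0_def Quotient_abs_rep[OF Quotient_torus])
  then have f_x0: "?f x0 = y" using \<open>p \<in> g -` {y}\<close> by (simp add: torus_lift_def)
  obtain I :: "'d set" where I: "card I = j"
    using obtain_subset_with_card_n[of j "UNIV :: 'd set"] card by auto
  have cI: "CARD('m) + card I = CARD('d)" using card I by simp
  have "card (- I) = CARD('m)" using card I by (simp add: Compl_eq_Diff_UNIV card_Diff_subset)
  then obtain \<sigma> where \<sigma>: "bij_betw \<sigma> (- I) (UNIV :: 'm set)"
    using finite_same_card_bij[of "- I" "UNIV :: 'm set"] by auto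
  obtain T :: "real ^ 'd \<Rightarrow> real ^ 'd" where T': "linear T" "\<forall>x i. i \<notin> I \<longrightarrow> T x $ i = 0"
    "\<forall>x. T x = 0 \<longrightarrow> ?J x0 *v x = 0 \<longrightarrow> x = 0"
    by (rule complement_coordinates[OF reg[OF f_x0] cI])
  note T = T'(1) T'(2,3)[rule_format]
  \<comment> \<open>Places the m components of a value into the coordinates outside
    \<open>I\<close>, in the order given by \<open>\<sigma>\<close>.\<close>
  define E where "E w = (\<chi> i. if i \<in> I then 0 else w $ \<sigma> i)" for w :: "real ^ 'm"
  have E: "linear E" by (rule linearI) (auto simp: E_def vec_eq_iff)
  have E_inj: "w = 0" if "\<And>i. i \<notin> I \<Longrightarrow> E w $ i = 0" for w
  proof (rule vec_eq_iff[THEN iffD2, rule_format])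
    fix k
    obtain i where "i \<notin> I" "\<sigma> i = k" using \<sigma> by (metis ComplD UNIV_I bij_betwE bij_betw_inv_into_right bij_betw_def imageE)
    then show "w $ k = 0 $ k" using that[of i] by (simp add: E_def)
  qed
  define h where "h x = T (x - x0) + E (?f x - y)" for x
  define H where "H x = matrix T + matrix E ** ?J x" for x
  have Hv: "H x *v v = T v + E (?J x *v v)" for x v
    using T(1) E by (simp add: H_def matrix_vector_mult_add_rdistrib flip: matrix_vector_mul_assoc)
  obtain U V where UV: "C1_diffeomorphism U V h" "x0 \<in> U" "U \<subseteq> ball x0 (1 / 2)"
  proof (rule C1_local_diffeomorphism[of h H x0 "1 / 2"])
    fix x
    have "(?f has_derivative (\<lambda>v. ?J x *v v)) (at x)" using diff jacobian_works by blast
    then have "((\<lambda>x. ?f x - y) has_derivative (\<lambda>v. ?J x *v v)) (at x)"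
      using has_derivative_diff[OF _ has_derivative_const[of y "at x"]] by fastforce
    then have dE: "((\<lambda>x. E (?f x - y)) has_derivative (\<lambda>v. E (?J x *v v))) (at x)"
      by (rule bounded_linear.has_derivative[OF E[unfolded linear_conv_bounded_linear]])
    have "((\<lambda>x. x - x0) has_derivative (\<lambda>v. v)) (at x)"
      using has_derivative_diff[OF has_derivative_ident has_derivative_const[of x0 "at x"]] by simp
    then have "((\<lambda>x. T (x - x0)) has_derivative (\<lambda>v. T v)) (at x)"
      by (rule bounded_linear.has_derivative[OF T(1)[unfolded linear_conv_bounded_linear]])
    from has_derivative_add[OF this dE]
    have "(h has_derivative (\<lambda>v. T v + E (?J x *v v))) (at x)" unfolding h_def .
    then show "(h has_derivative (\<lambda>v. H x *v v)) (at x)" by (simp add: Hv)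
  next
    show "continuous_on UNIV H"
      unfolding H_def matrix_matrix_mult_def by (intro continuous_intros cont)
  next
    fix v assume "H x0 *v v = 0"
    then have *: "T v + E (?J x0 *v v) = 0" by (simp add: Hv)
    have "E (?J x0 *v v) $ i = 0" if "i \<notin> I" for i
      using arg_cong[OF *, of "\<lambda>z. z $ i"] T(2)[OF that] by simp
    then have "?J x0 *v v = 0" by (rule E_inj)
    then show "v = 0" using * T(3) linear_0[OF E] by simp
  qed auto
  have h_zero: "(\<forall>i. i \<notin> I \<longrightarrow> h x $ i = 0) \<longleftrightarrow> ?f x = y" for x
  proof
    assume *: "\<forall>i. i \<notin> I \<longrightarrow> h x $ i = 0"
    have "?f x - y = 0" by (rule E_inj) (use * T(2) in \<open>simp add: h_def\<close>)
    then show "?f x = y" by simp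
  next
    assume "?f x = y"
    then show "\<forall>i. i \<notin> I \<longrightarrow> h x $ i = 0" using T(2) linear_0[OF E] by (simp add: h_def)
  qed
  have hU: "h ` U = V" using UV(1) by (auto simp: C1_diffeomorphism_def homeomorphism_def)
  have "h ` (U \<inter> to_torus -` (g -` {y})) = V \<inter> {z. \<forall>i. i \<notin> I \<longrightarrow> z $ i = 0}"
  proof -
    have "to_torus -` (g -` {y}) = {x. \<forall>i. i \<notin> I \<longrightarrow> h x $ i = 0}"
      by (simp add: h_zero torus_lift_def vimage_def)
    then show ?thesis using hU by auto
  qed
  moreover have "inj_on to_torus U" using inj_on_to_torus_ball UV(3) by (rule inj_on_subset)
  moreover have "p \<in> to_torus ` U" using x0 UV(2) by blast
  ultimately show "\<exists>U V h I. inj_on to_torus U \<and> p \<in> to_torus ` U \<and> C1_diffeomorphism U V h \<and> card I = j \<and>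
      h ` (U \<inter> to_torus -` (g -` {y})) = V \<inter> {z :: real ^ 'd. \<forall>i. i \<notin> I \<longrightarrow> z $ i = 0}"
    using UV(1) I by blast
qed

subsection \<open>The expected volume of the cover\<close>

text \<open>The pointwise infimum has integral below every \<open>a n\<close>, hence vanishes almost
  surely. This yields one good level for each tolerance, which is all that a null set needs.\<close>

lemma AE_ex_small_of_nn_integral_tendsto_0:
  fixes X :: "nat \<Rightarrow> 'a \<Rightarrow> ennreal"
  assumes [measurable]: "\<And>n. X n \<in> borel_measurable M"
    and le: "\<And>n. (\<integral>\<^sup>+x. X n x \<partial>M) \<le> ennreal (a n)" and lim: "a \<longlonglongrightarrow> 0"
  shows "AE x in M. \<forall>e>0. \<exists>n. X n x < e"
proof -
  have "(\<integral>\<^sup>+x. (INF n. X n x) \<partial>M) \<le> ennreal (a n)" for n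
    by (rule order_trans[OF nn_integral_mono le]) (auto intro: INF_lower)
  moreover have "(\<lambda>n. ennreal (a n)) \<longlonglongrightarrow> ennreal 0" using lim by (rule tendsto_ennrealI)
  ultimately have "(\<integral>\<^sup>+x. (INF n. X n x) \<partial>M) \<le> ennreal 0"
    by (intro tendsto_lowerbound[of _ _ sequentially]) auto
  then have "AE x in M. (INF n. X n x) = 0" by (subst (asm) ennreal_0) (simp add: nn_integral_0_iff_AE)
  then show ?thesis by eventually_elim (metis INF_less_iff UNIV_I)
qed

text \<open>The constant \<open>K\<close> is fixed here. The implication stays inside the almost
  sure statement: the random variables \<open>X n\<close> live on all of \<open>P\<close>, and the
  Hoelder bound is only used afterwards, at each single \<open>\<phi>\<close>.\<close>

lemma AE_negligible_critical_values:
  fixes P :: "('d::finite torus \<Rightarrow>\<^sub>C (real ^ 'm::finite)) measure" and \<alpha> C\<^sub>0 K :: real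
  assumes P: "prob_space P" "sets P = sets borel" and card: "CARD('m) + j = CARD('d)"
    and \<alpha>: "0 < \<alpha>" "\<alpha> > real j / (2 + real j)" and K: "1 \<le> K"
    and conc: "\<And>r x\<^sub>0 (M\<^sub>0 :: real ^ 'd ^ 'm). r > 0 \<Longrightarrow>
      measure P {\<phi>. torus_differentiable (apply_bcontfun \<phi>) x\<^sub>0 \<and>
                     norm (torus_jacobian (apply_bcontfun \<phi>) x\<^sub>0 - M\<^sub>0) \<le> r}
        \<le> C\<^sub>0 * r ^ (CARD('d) * CARD('m))"
  shows "AE \<phi> in P. torus_C1_holder_bound \<alpha> K (apply_bcontfun \<phi>) \<longrightarrow>
    negligible (torus_lift (apply_bcontfun \<phi>) `
      {x. \<not> surj ((*v) (jacobian (torus_lift (apply_bcontfun \<phi>)) (at x)))})"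
proof -
  interpret prob_space P by fact
  define m where "m = real CARD('m)"
  define d where "d = real CARD('d)"
  define N where "N = (CARD('m) - 1) * (CARD('d) + 1)"
  define \<epsilon> where "\<epsilon> = (\<lambda>n::nat. 1 / 2 ^ n :: real)"
  define \<delta> where "\<delta> n = \<epsilon> n powr \<alpha>" for n
  \<comment> \<open>Radius of the net plus the variation of the Jacobian over a cell, both being
    multiples of \<open>\<delta> n\<close>.\<close>
  define c where "c = m * (d * (m * (K + 2))) + K * d powr \<alpha>"
  define B where "B = 2 * m * (m * K) * (5 * (m * K) * (1 + d powr \<alpha>)) ^ (CARD('m) - 1) * d powr (m + \<alpha>)"
  have md: "1 \<le> m" "1 \<le> d" by (auto simp: m_def d_def Suc_leI)
  have \<epsilon>: "0 < \<epsilon> n" "\<epsilon> n \<le> 1" for n by (auto simp: \<epsilon>_def divide_le_eq)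
  have \<delta>: "0 < \<delta> n" "\<delta> n \<le> 1" for n
    using \<epsilon>[of n] \<alpha> powr_le1[of \<alpha> "\<epsilon> n"] by (auto simp: \<delta>_def)
  have c: "0 < c" using md K by (auto simp: c_def intro!: add_pos_nonneg)
  have B: "0 \<le> B" using md K by (auto simp: B_def)
  \<comment> \<open>A measure is nonnegative, so radius 1 at any point and matrix gives the
    sign.\<close>
  have C\<^sub>0: "0 \<le> C\<^sub>0" using conc[of 1 undefined undefined] by (simp add: order_trans[OF measure_nonneg])
  have "\<forall>n. \<exists>Z :: (real ^ 'd ^ 'm) set. finite Z \<and> real (card Z) * \<delta> n ^ N \<le> m * (2 * K + 3) ^ N \<and>
      (\<forall>A. \<not> surj ((*v) A) \<longrightarrow> norm A \<le> K \<longrightarrow> (\<exists>M\<in>Z. norm (A - M) \<le> m * (d * (m * ((K + 2) * \<delta> n)))))"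
  proof
    fix n
    show "\<exists>Z :: (real ^ 'd ^ 'm) set. finite Z \<and> real (card Z) * \<delta> n ^ N \<le> m * (2 * K + 3) ^ N \<and>
      (\<forall>A. \<not> surj ((*v) A) \<longrightarrow> norm A \<le> K \<longrightarrow> (\<exists>M\<in>Z. norm (A - M) \<le> m * (d * (m * ((K + 2) * \<delta> n)))))"
      unfolding m_def d_def N_def
      by (rule degenerate_matrix_net[OF K \<delta>]) (intro exI conjI allI impI)
  qed
  from choice[OF this] obtain Z :: "nat \<Rightarrow> (real ^ 'd ^ 'm) set"
    where Z: "\<And>n. finite (Z n)" "\<And>n. real (card (Z n)) * \<delta> n ^ N \<le> m * (2 * K + 3) ^ N"
    and net: "\<And>n A. \<not> surj ((*v) A) \<Longrightarrow> norm A \<le> K \<Longrightarrow>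
      \<exists>M\<in>Z n. norm (A - M) \<le> m * (d * (m * ((K + 2) * \<delta> n)))" by blast
  define E where "E = (\<lambda>n q M. {\<phi> :: 'd torus \<Rightarrow>\<^sub>C (real ^ 'm).
    torus_differentiable (apply_bcontfun \<phi>) (to_torus (grid_point n q)) \<and>
    norm (torus_jacobian (apply_bcontfun \<phi>) (to_torus (grid_point n q)) - M) \<le> c * \<delta> n})"
  define bad where "bad n q = (\<Union>M\<in>Z n. E n q M)" for n q
  define V where "V n = B * \<epsilon> n powr (m + \<alpha>)" for n
  define X where "X n \<phi> = (\<Sum>q\<in>torus_grid n. ennreal (V n) * indicator (bad n q) \<phi>)" for n \<phi>
  have V: "0 \<le> V n" for n using B by (simp add: V_def)
  have E_meas [measurable]: "E n q M \<in> sets P" for n q M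
    unfolding E_def P(2) by (rule borel_differentiable_jacobian_cball)
  have bad_meas [measurable]: "bad n q \<in> sets P" for n q
    unfolding bad_def using Z(1) by auto
  have prob_bad: "measure P (bad n q) \<le> m * (2 * K + 3) ^ N * (C\<^sub>0 * c ^ (CARD('d) * CARD('m))) * \<delta> n ^ (j + 1)" for n q
  proof -
    \<comment> \<open>Splits the exponent of (b) into the dimension \<open>N\<close> of the
      degenerate matrices and their codimension j + 1: the size of the net cancels
      \<open>\<delta> n ^ N\<close>, and \<open>\<delta> n ^ (j + 1)\<close> remains.\<close>
    have exps: "CARD('d) * CARD('m) = N + (j + 1)"
    proof -
      obtain m' where "CARD('m) = Suc m'" using not0_implies_Suc[of "CARD('m)"] by auto
      then show ?thesis unfolding N_def card[symmetric] by (simp add: algebra_simps)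
    qed
    have "measure P (bad n q) \<le> (\<Sum>M\<in>Z n. measure P (E n q M))"
      unfolding bad_def using Z(1) by (intro measure_UNION_le) auto
    also have "\<dots> \<le> real (card (Z n)) * (C\<^sub>0 * (c * \<delta> n) ^ (CARD('d) * CARD('m)))"
      unfolding E_def using c \<delta> by (intro sum_bounded_above conc) simp
    also have "\<dots> = (real (card (Z n)) * \<delta> n ^ N) * (C\<^sub>0 * c ^ (CARD('d) * CARD('m)) * \<delta> n ^ (j + 1))"
      unfolding power_mult_distrib exps power_add by (simp only: mult_ac)
    also have "\<dots> \<le> (m * (2 * K + 3) ^ N) * (C\<^sub>0 * c ^ (CARD('d) * CARD('m)) * \<delta> n ^ (j + 1))"
      using Z(2) C\<^sub>0 c \<delta>(1)[of n] by (intro mult_right_mono) auto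
    finally show ?thesis by (simp only: mult_ac)
  qed
  \<comment> \<open>Sum of the exponents of \<open>\<epsilon> n\<close>: -d from the number of
    cells, m + \<open>\<alpha>\<close> from the volume and \<open>\<alpha>\<close> (j + 1) from the
    probability, where m - d = -j. It is positive exactly when \<open>\<alpha>\<close> exceeds j /
    (2 + j).\<close>
  define \<gamma> where "\<gamma> = \<alpha> * (real j + 2) - real j"
  have \<gamma>: "0 < \<gamma>" using \<alpha>(2) by (simp add: \<gamma>_def field_simps)
  define C where "C = B * (m * (2 * K + 3) ^ N * (C\<^sub>0 * c ^ (CARD('d) * CARD('m))))"
  have expect: "(\<integral>\<^sup>+\<phi>. X n \<phi> \<partial>P) \<le> ennreal (C * \<epsilon> n powr \<gamma>)" for n
  proof -
    have "(\<integral>\<^sup>+\<phi>. X n \<phi> \<partial>P) = (\<Sum>q\<in>torus_grid n. ennreal (V n) * emeasure P (bad n q))"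
      unfolding X_def by (subst nn_integral_sum) (auto simp: nn_integral_cmult)
    also have "\<dots> = (\<Sum>q\<in>torus_grid n. ennreal (V n * measure P (bad n q)))"
      by (simp add: emeasure_eq_measure ennreal_mult V)
    also have "\<dots> = ennreal (\<Sum>q\<in>torus_grid n. V n * measure P (bad n q))"
      using V by (intro sum_ennreal) simp
    also have "\<dots> \<le> ennreal (C * \<epsilon> n powr \<gamma>)"
    proof (rule ennreal_leI)
      have "(\<Sum>q\<in>torus_grid n. V n * measure P (bad n q))
          \<le> real (card (torus_grid n :: ('d \<Rightarrow> nat) set)) * (V n * (m * (2 * K + 3) ^ N * (C\<^sub>0 * c ^ (CARD('d) * CARD('m))) * \<delta> n ^ (j + 1)))"
        using V by (intro sum_bounded_above mult_left_mono prob_bad)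
      also have "real (card (torus_grid n :: ('d \<Rightarrow> nat) set)) = \<epsilon> n powr (- d)"
        by (simp add: card_torus_grid \<epsilon>_def powr_minus d_def powr_realpow power_one_over)
      also have "\<epsilon> n powr (- d) * (V n * (m * (2 * K + 3) ^ N * (C\<^sub>0 * c ^ (CARD('d) * CARD('m))) * \<delta> n ^ (j + 1)))
         = C * (\<epsilon> n powr (- d) * (\<epsilon> n powr (m + \<alpha>) * \<delta> n ^ (j + 1)))"
        unfolding C_def V_def by (simp only: mult_ac)
      also have "\<delta> n ^ (j + 1) = \<epsilon> n powr (\<alpha> * (real j + 1))"
        using \<delta>(1)[of n] powr_realpow[of "\<delta> n" "j + 1"] by (simp add: \<delta>_def powr_powr add.commute)
      also have "\<epsilon> n powr (- d) * (\<epsilon> n powr (m + \<alpha>) * \<epsilon> n powr (\<alpha> * (real j + 1)))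
          = \<epsilon> n powr (- d + (m + \<alpha> + \<alpha> * (real j + 1)))"
        by (simp only: powr_add)
      also have "- d + (m + \<alpha> + \<alpha> * (real j + 1)) = \<gamma>"
        unfolding \<gamma>_def m_def d_def card[symmetric] by (simp add: algebra_simps)
      finally show "(\<Sum>q\<in>torus_grid n. V n * measure P (bad n q)) \<le> C * \<epsilon> n powr \<gamma>" .
    qed
    finally show ?thesis .
  qed
  have "(\<lambda>n. (1 / 2 :: real) ^ n) \<longlonglongrightarrow> 0" by (rule LIMSEQ_realpow_zero) auto
  then have "\<epsilon> \<longlonglongrightarrow> 0" by (simp add: \<epsilon>_def power_one_over)
  then have "(\<lambda>n. \<epsilon> n powr \<gamma>) \<longlonglongrightarrow> 0"
    using \<gamma> \<epsilon> by (intro tendsto_zero_powrI[OF _ tendsto_const]) (auto intro!: always_eventually less_imp_le)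
  then have lim: "(\<lambda>n. C * \<epsilon> n powr \<gamma>) \<longlonglongrightarrow> 0" by (rule tendsto_mult_right_zero)
  have X_meas: "X n \<in> borel_measurable P" for n unfolding X_def by measurable
  have "AE \<phi> in P. \<forall>e>0. \<exists>n. X n \<phi> < e"
    by (rule AE_ex_small_of_nn_integral_tendsto_0[OF X_meas expect lim])
  then show ?thesis
  proof eventually_elim
    fix \<phi> assume small: "\<forall>e>0. \<exists>n. X n \<phi> < e"
    let ?f = "torus_lift (apply_bcontfun \<phi>)"
    show "torus_C1_holder_bound \<alpha> K (apply_bcontfun \<phi>) \<longrightarrow>
      negligible (?f ` {x. \<not> surj ((*v) (jacobian ?f (at x)))})"
      unfolding negligible_outer_le
    proof (intro impI allI)
      fix e :: real assume "0 < e" and hb: "torus_C1_holder_bound \<alpha> K (apply_bcontfun \<phi>)"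
      obtain n where n: "X n \<phi> < ennreal e" using small \<open>0 < e\<close> by (metis ennreal_less_zero_iff)
      let ?Q = "{q\<in>torus_grid n. \<exists>M\<in>Z n. norm (jacobian ?f (at (grid_point n q)) - M)
               \<le> m * (d * (m * ((K + 2) * \<delta> n))) + K * (d * (1 / 2 ^ n)) powr \<alpha>}"
      obtain T where T: "T \<in> lmeasurable" "?f ` {x. \<not> surj ((*v) (jacobian ?f (at x)))} \<subseteq> T"
        "measure lebesgue T \<le> card ?Q * (2 * CARD('m) * (CARD('m) * K) *
          (5 * (CARD('m) * K) * (1 + CARD('d) powr \<alpha>)) ^ (CARD('m) - 1)
         * (CARD('d) * (1 / 2 ^ n)) powr (CARD('m) + \<alpha>))"
        unfolding d_def by (rule critical_values_cover[OF hb \<alpha>(1) K net, unfolded d_def])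
      have "2 * CARD('m) * (CARD('m) * K) * (5 * (CARD('m) * K) * (1 + CARD('d) powr \<alpha>)) ^ (CARD('m) - 1)
         * (CARD('d) * (1 / 2 ^ n)) powr (CARD('m) + \<alpha>) = V n"
        unfolding V_def B_def m_def d_def \<epsilon>_def by (simp only: powr_mult mult_ac)
      with T(3) have TV: "measure lebesgue T \<le> card ?Q * V n" by simp
      have radius: "m * (d * (m * ((K + 2) * \<delta> n))) + K * (d * (1 / 2 ^ n)) powr \<alpha> = c * \<delta> n"
      proof -
        have "(d * (1 / 2 ^ n)) powr \<alpha> = d powr \<alpha> * \<delta> n"
          unfolding \<delta>_def \<epsilon>_def by (rule powr_mult)
        then show ?thesis by (simp only: c_def distrib_left distrib_right mult.assoc)
      qed
      \<comment> \<open>Under the Hoelder bound differentiability holds at every corner, so the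
        cells counted by the cover are exactly the bad ones, and \<open>X n \<phi>\<close> is the
        bound on the volume of \<open>T\<close>.\<close>
      have Q: "?Q = {q\<in>torus_grid n. \<phi> \<in> bad n q}"
        using hb unfolding radius bad_def E_def torus_C1_holder_bound_def
          torus_differentiable_to_torus torus_jacobian_to_torus by auto
      have "X n \<phi> = (\<Sum>q\<in>?Q. ennreal (V n))"
        unfolding X_def Q
        by (intro sum.mono_neutral_cong_right) (auto simp: finite_torus_grid indicator_def)
      also have "\<dots> = ennreal (card ?Q * V n)" using V by (simp add: ennreal_mult ennreal_of_nat_eq_real_of_nat)
      finally have "card ?Q * V n < e" using n \<open>0 < e\<close> by (simp add: ennreal_less_iff V)
      then show "\<exists>T. ?f ` {x. \<not> surj ((*v) (jacobian ?f (at x)))} \<subseteq> T \<and> T \<in> lmeasurable \<and> measure lebesgue T \<le> e"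
        using T TV by (intro exI[of _ T]) auto
    qed
  qed
qed

theorem theorem1p5:
  fixes P :: "('d::finite torus \<Rightarrow>\<^sub>C (real ^ 'm::finite)) measure"
    and j :: nat and \<alpha> C\<^sub>0 :: real
  assumes "CARD('d) \<ge> 2" "1 \<le> j" "j \<le> CARD('d) - 1" "CARD('m) = CARD('d) - j"
    and "prob_space P" "sets P = sets borel"
    and "\<alpha> > real j / (2 + real j)"
    and "AE \<phi> in P. torus_C1_holder \<alpha> (apply_bcontfun \<phi>)"
    and "\<And>r (x\<^sub>0 :: 'd torus) (M\<^sub>0 :: real ^ 'd ^ 'm). r > 0 \<Longrightarrow>
      measure P {\<phi>. torus_differentiable (apply_bcontfun \<phi>) x\<^sub>0 \<and>
                     norm (torus_jacobian (apply_bcontfun \<phi>) x\<^sub>0 - M\<^sub>0) \<le> r}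
        \<le> C\<^sub>0 * r ^ (CARD('d) * (CARD('d) - j))"
  shows "AE \<phi> in P. morse_sard j (apply_bcontfun \<phi>)"
proof -
  have card: "CARD('m) + j = CARD('d)" using assms(1-4) by linarith
  have "0 \<le> real j / (2 + real j)" by simp
  then have "0 < \<alpha>" using assms(7) by linarith
  have "AE \<phi> in P. torus_C1_holder_bound \<alpha> (real (Suc k)) (apply_bcontfun \<phi>) \<longrightarrow>
      negligible (torus_lift (apply_bcontfun \<phi>) `
        {x. \<not> surj ((*v) (jacobian (torus_lift (apply_bcontfun \<phi>)) (at x)))})" for k
    using assms(4-7,9) card \<open>0 < \<alpha>\<close> by (intro AE_negligible_critical_values[where j = j]) auto
  \<comment> \<open>The quantifier over the constants moves inside because they are countable; the
    one that fits \<open>\<phi>\<close> can then be chosen pointwise.\<close>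
  then have "AE \<phi> in P. \<forall>k. torus_C1_holder_bound \<alpha> (real (Suc k)) (apply_bcontfun \<phi>) \<longrightarrow>
      negligible (torus_lift (apply_bcontfun \<phi>) `
        {x. \<not> surj ((*v) (jacobian (torus_lift (apply_bcontfun \<phi>)) (at x)))})"
    by (simp only: AE_all_countable) simp
  with assms(8) show ?thesis
  proof eventually_elim
    case (elim \<phi>)
    let ?g = "apply_bcontfun \<phi>"
    let ?crit = "{x. \<not> surj ((*v) (jacobian (torus_lift ?g) (at x)))}"
    obtain k where "torus_C1_holder_bound \<alpha> (real (Suc k)) ?g"
      using torus_C1_holder_imp_bound[OF elim(1)] \<open>0 < \<alpha>\<close> by (metis less_imp_le)
    then have "negligible (torus_lift ?g ` ?crit)" using elim(2) by blast
    then have null: "torus_lift ?g ` ?crit \<in> null_sets lebesgue" by (simp add: negligible_iff_null_sets)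
    have diff: "torus_lift ?g differentiable at x" for x
      using elim(1) unfolding torus_C1_holder_def by (metis torus_differentiable_to_torus)
    have cont: "continuous_on UNIV (\<lambda>x. jacobian (torus_lift ?g) (at x))"
      using continuous_on_compose2[OF _ continuous_on_to_torus[of UNIV], of UNIV "torus_jacobian ?g"] elim(1)
      by (simp add: torus_C1_holder_def torus_jacobian_to_torus)
    \<comment> \<open>A value off the critical image is either regular or not attained; in the
      second case the fibre is empty.\<close>
    have "torus_C1_submanifold j (?g -` {y})" if "y \<notin> torus_lift ?g ` ?crit" for y
      using that card by (intro regular_value_submanifold diff cont) auto
    then show "morse_sard j ?g"
      unfolding morse_sard_def by (intro AE_I'[OF null]) blast
  qed
qed

end
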